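(* Let $g$ be a regular kernel on the finite alphabet $S$ which exhibits dynamic uniqueness. Then the unique $g$-measure is weak Bernoulli.
   Context: $S$ is a finite set, $\mathcal X=S^{\mathbb Z}$, $\mathcal X^-=S^{\{-1,-2,\dots\}}$. Sequences are written with the past to the right: $x_j^i=(x_i,\dots,x_j)$ for $j\le i$, $x_{-\infty}^i=(x_i,x_{i-1},\dots)$, $\underline x=x_{-\infty}^{-1}$; concatenations are read in the same order, sequences indexed by a left half-line of $\mathbb Z$ being identified by shifting indices. For $I\subset\mathbb R$, $\mathcal F_I$ is the $\sigma$-algebra on $\mathcal X$ generated by the coordinates with index in $I\cap\mathbb Z$; $\mathcal F=\mathcal F_{\mathbb R}$, $\mathcal F^-=\mathcal F_{(-\infty,-1]}$, and $\mathcal T^+=\bigcap_{n\ge1}\mathcal F_{[n,\infty)}$. A (probability) kernel $g$ on $S$ is a measurable function assigning to each $a\in S$, $\underline x\in\mathcal X^-$ a number $g(a\underline x)\in[0,1]$ with $\sum_{a\in S}g(a\underline x)=1$ for all $\underline x$. It is strongly non-null if $\inf_{a,\underline x}g(a\underline x)>0$. It is continuous if $\mathrm{var}_k(g)=\sup_{a\in S}\sup_{\omega_{-k}^{-1}\in S^k}\sup_{\underline x,\underline y\in\mathcal X^-}|g(a\omega_{-k}^{-1}\underline x)-g(a\omega_{-k}^{-1}\underline y)|\to0$ as $k\to\infty$. It is regular if it is strongly non-null and continuous. A $g$-measure is a stationary (shift-invariant) probability measure $P$ on $(\mathcal X,\mathcal F)$, with canonical process $(X_j)_{j\in\mathbb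 Z}$, such that $P[X_0=a\mid X_{-\infty}^{-1}=\underline x]=g(a\underline x)$ for every $a\in S$ and $P$-a.e. $x$. A regular kernel that exhibits dynamic uniqueness has exactly one $g$-measure. For $\underline x\in\mathcal X^-$, $P^{\underline x}$ is the probability measure on $(\mathcal X,\mathcal F)$ under which $X_{-\infty}^{-1}=\underline x$ almost surely and, for $j\ge0$, $P^{\underline x}[X_j=a\mid X_{-\infty}^{j-1}=y_{-\infty}^{j-1}]=g(ay_{-\infty}^{j-1})$. The kernel $g$ exhibits dynamic uniqueness if $P^{\underline x}[A]=P^{\underline y}[A]$ for all $A\in\mathcal T^+$ and all $\underline x,\underline y\in\mathcal X^-$. A stationary measure $\mu$ on $(\mathcal X,\mathcal F)$ is weak Bernoulli (equivalently absolutely regular, $\beta$-mixing) if $\lim_{n\to\infty}d_{TV}\big(\mu|_{\mathcal F^-}\otimes\mu|_{\mathcal F_{[n,\infty)}},\ \mu|_{\mathcal F^-\otimes\mathcal F_{[n,\infty)}}\big)=0$, where $d_{TV}(\mu,\nu)=2\sup_A|\mu(A)-\nu(A)|$, $\mathcal F^-\otimes\mathcal F_{[n,\infty)}$ is the sub-$\sigma$-algebra of $\mathcal F$ generated by the rectangles $A\times B$ (the joint events "$A$ and $B$") with $A\in\mathcal F^-$, $B\in\mathcal F_{[n,\infty)}$, $\mu|_{\mathcal F^-}\otimes\mu|_{\mathcal F_{[n,\infty)}}$ is the product measure of the two restrictions, and $\mu|_{\mathcal F^-\otimes\mathcal F_{[n,\infty)}}$ is the restriction of $\mu$. *)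

theory Defs
  imports "HOL-Probability.Probability"
begin

text \<open>
  The alphabet is a finite type \<open>'s\<close>. Two-sided sequences are functions \<open>int \<Rightarrow> 's\<close>.
  Sequences indexed by a left half-line are streams, read from the present into the past:
  the head of \<open>past j x\<close> is \<open>x j\<close>, so \<open>past (-1) x\<close> is the element of \<open>X\<^sup>-\<close> given by \<open>x\<close>,
  and \<open>a ## past (j - 1) x\<close> is the concatenation of the letter \<open>a\<close> with the past of \<open>x\<close> before \<open>j\<close>.
  Accordingly, a word \<open>w\<close> of length \<open>k\<close> lists the letters at the times \<open>-1, \<dots>, -k\<close>, in this order.
\<close>

definition past :: "int \<Rightarrow> (int \<Rightarrow> 's) \<Rightarrow> 's stream" where
  "past j x = to_stream (\<lambda>k. x (j - int k))"

definition coord_alg :: "int set \<Rightarrow> (int \<Rightarrow> 's) measure" where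
  "coord_alg I = sigma UNIV {{x. x i = a} | i a. i \<in> I}"

definition tail_events :: "(int \<Rightarrow> 's) set set" where
  "tail_events = (\<Inter>n\<in>{1..}. sets (coord_alg {n..}))"

lemma space_coord_alg [simp]: "space (coord_alg I) = UNIV"
  by (simp add: coord_alg_def space_measure_of_conv)

lemma sets_coord_alg:
  "sets (coord_alg I) = sigma_sets UNIV {{x. x i = a} | i a. i \<in> I}"
  by (simp add: coord_alg_def sets_measure_of_conv)

lemma sets_coord_alg_UNIV:
  "sets (coord_alg UNIV :: (int \<Rightarrow> 's::finite) measure) = sets (Pi\<^sub>M UNIV (\<lambda>_. count_space UNIV))"
proof (rule antisym)
  have "{x. x i = a} \<in> sets (Pi\<^sub>M UNIV (\<lambda>_. count_space UNIV))" for i :: int and a :: 's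
    using sets_Collect_single[of i UNIV "{a}" "\<lambda>_. count_space UNIV"] by (simp add: space_PiM)
  then show "sets (coord_alg UNIV :: (int \<Rightarrow> 's) measure) \<subseteq> sets (Pi\<^sub>M UNIV (\<lambda>_. count_space UNIV))"
    unfolding sets_coord_alg
    using sets.sigma_sets_subset[of "{{x. x i = a} | i a. i \<in> UNIV}"
        "Pi\<^sub>M UNIV (\<lambda>_::int. count_space (UNIV :: 's set))"]
    by (simp add: space_PiM) blast
next
  have "{x. x i \<in> A} \<in> sets (coord_alg UNIV)" for i :: int and A :: "'s set"
  proof -
    have "{x. x i = a} \<in> sets (coord_alg UNIV)" for a :: 's
      unfolding sets_coord_alg by (auto intro: sigma_sets.Basic)
    then have "(\<Union>a\<in>A. {x. x i = a}) \<in> sets (coord_alg UNIV)"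
      by (intro sets.finite_UN) auto
    then show ?thesis by (simp add: UN_extend_simps Collect_bex_eq[symmetric])
  qed
  then show "sets (Pi\<^sub>M UNIV (\<lambda>_. count_space UNIV)) \<subseteq> sets (coord_alg UNIV :: (int \<Rightarrow> 's) measure)"
    unfolding sets_PiM_single
    using sets.sigma_sets_subset[of "{{x. x i \<in> A} | i A. i \<in> UNIV}"
        "coord_alg UNIV :: (int \<Rightarrow> 's) measure"]
    by simp blast
qed

lemma subalgebra_coord_alg:
  assumes "sets M = sets (coord_alg UNIV)"
  shows "subalgebra M (coord_alg I)"
proof -
  have "sets (coord_alg I) \<subseteq> sets M"
    unfolding assms sets_coord_alg by (rule sigma_sets_mono') auto
  then show ?thesis
    using sets_eq_imp_space_eq[OF assms] by (simp add: subalgebra_def)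
qed

definition kernel :: "('s::finite stream \<Rightarrow> real) \<Rightarrow> bool" where
  "kernel g \<longleftrightarrow>
     g \<in> borel_measurable (stream_space (count_space UNIV)) \<and>
     (\<forall>x. 0 \<le> g x \<and> g x \<le> 1) \<and>
     (\<forall>x. (\<Sum>a\<in>UNIV. g (a ## x)) = 1)"

definition strongly_non_null :: "('s stream \<Rightarrow> real) \<Rightarrow> bool" where
  "strongly_non_null g \<longleftrightarrow> (INF (a, x)\<in>UNIV. g (a ## x)) > 0"

definition kernel_var :: "nat \<Rightarrow> ('s stream \<Rightarrow> real) \<Rightarrow> real" where
  "kernel_var k g =
     (SUP a. SUP w\<in>{w. length w = k}. SUP (x, y)\<in>UNIV. \<bar>g (a ## w @- x) - g (a ## w @- y)\<bar>)"

definition continuous_kernel :: "('s stream \<Rightarrow> real) \<Rightarrow> bool" where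
  "continuous_kernel g \<longleftrightarrow> (\<lambda>k. kernel_var k g) \<longlonglongrightarrow> 0"

definition regular_kernel :: "('s::finite stream \<Rightarrow> real) \<Rightarrow> bool" where
  "regular_kernel g \<longleftrightarrow> kernel g \<and> strongly_non_null g \<and> continuous_kernel g"

text \<open>A version of the conditional law of \<open>X\<^sub>j\<close> given the coordinates before \<open>j\<close> is given by \<open>g\<close>.\<close>

definition follows_kernel_at :: "int \<Rightarrow> ('s stream \<Rightarrow> real) \<Rightarrow> (int \<Rightarrow> 's) measure \<Rightarrow> bool" where
  "follows_kernel_at j g P \<longleftrightarrow>
     (\<forall>a. AE x in P. real_cond_exp P (coord_alg {..j - 1}) (indicator {x. x j = a}) x
                       = g (a ## past (j - 1) x))"

definition stationary :: "(int \<Rightarrow> 's) measure \<Rightarrow> bool" where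
  "stationary P \<longleftrightarrow> distr P P (\<lambda>x i. x (i + 1)) = P"

definition g_measure :: "('s stream \<Rightarrow> real) \<Rightarrow> (int \<Rightarrow> 's) measure \<Rightarrow> bool" where
  "g_measure g P \<longleftrightarrow>
     prob_space P \<and> sets P = sets (coord_alg UNIV) \<and> stationary P \<and> follows_kernel_at 0 g P"

text \<open>
  \<open>started_from g x P\<close> characterises the law \<open>P\<close> of the process started from the past \<open>x\<close>;
  by the Ionescu-Tulcea theorem there is exactly one such \<open>P\<close> for every kernel \<open>g\<close> and past \<open>x\<close>.
\<close>

definition started_from :: "('s stream \<Rightarrow> real) \<Rightarrow> 's stream \<Rightarrow> (int \<Rightarrow> 's) measure \<Rightarrow> bool" where
  "started_from g x P \<longleftrightarrow>
     prob_space P \<and> sets P = sets (coord_alg UNIV) \<and>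
     (AE z in P. past (- 1) z = x) \<and> (\<forall>j\<ge>0. follows_kernel_at j g P)"

definition dynamic_uniqueness :: "('s stream \<Rightarrow> real) \<Rightarrow> bool" where
  "dynamic_uniqueness g \<longleftrightarrow>
     (\<forall>x y P Q. started_from g x P \<longrightarrow> started_from g y Q \<longrightarrow>
        (\<forall>A\<in>tail_events. measure P A = measure Q A))"

definition d_TV :: "'b measure \<Rightarrow> 'b measure \<Rightarrow> real" where
  "d_TV M N = 2 * (SUP A\<in>sets M. \<bar>measure M A - measure N A\<bar>)"

definition joint_alg :: "nat \<Rightarrow> (int \<Rightarrow> 's) measure" where
  "joint_alg n = sigma UNIV
     {A \<inter> B | A B. A \<in> sets (coord_alg {..- 1}) \<and> B \<in> sets (coord_alg {int n..})}"

text \<open>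
  The product of the two restrictions of \<open>M\<close> lives on pairs of sequences. It is transported to
  \<open>joint_alg n\<close> by gluing the past of the first sequence to the future of the second; the result
  is the measure with \<open>A \<inter> B \<mapsto> M A * M B\<close> (lemma \<open>emeasure_joint_product\<close>).
\<close>

definition glue :: "(int \<Rightarrow> 's) \<times> (int \<Rightarrow> 's) \<Rightarrow> int \<Rightarrow> 's" where
  "glue = (\<lambda>(x, y) i. if i < 0 then x i else y i)"

definition joint_product :: "nat \<Rightarrow> (int \<Rightarrow> 's) measure \<Rightarrow> (int \<Rightarrow> 's) measure" where
  "joint_product n M =
     distr (restr_to_subalg M (coord_alg {..- 1}) \<Otimes>\<^sub>M restr_to_subalg M (coord_alg {int n..}))
       (joint_alg n) glue"

definition weak_bernoulli :: "(int \<Rightarrow> 's) measure \<Rightarrow> bool" where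
  "weak_bernoulli M \<longleftrightarrow>
     (\<lambda>n. d_TV (joint_product n M) (restr_to_subalg M (joint_alg n))) \<longlonglongrightarrow> 0"

lemma space_joint_alg [simp]: "space (joint_alg n) = UNIV"
  by (simp add: joint_alg_def space_measure_of_conv)

lemma sets_joint_alg:
  "sets (joint_alg n) =
     sigma_sets UNIV {A \<inter> B | A B. A \<in> sets (coord_alg {..- 1}) \<and> B \<in> sets (coord_alg {int n..})}"
  by (simp add: joint_alg_def sets_measure_of_conv)

lemma subalgebra_joint_alg:
  assumes "sets M = sets (coord_alg UNIV)"
  shows "subalgebra M (joint_alg n)"
proof -
  have "{A \<inter> B | A B. A \<in> sets (coord_alg {..- 1}) \<and> B \<in> sets (coord_alg {int n..})} \<subseteq> sets M"
    using subalgebra_coord_alg[OF assms] by (auto simp: subalgebra_def)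
  then have "sets (joint_alg n) \<subseteq> sets M"
    unfolding sets_joint_alg
    using sets.sigma_sets_subset[of _ M] sets_eq_imp_space_eq[OF assms] by simp
  then show ?thesis
    using sets_eq_imp_space_eq[OF assms] by (simp add: subalgebra_def)
qed

lemma coord_alg_cong:
  assumes "A \<in> sets (coord_alg I)" and "\<And>i. i \<in> I \<Longrightarrow> x i = y i"
  shows "x \<in> A \<longleftrightarrow> y \<in> A"
  using assms(1) unfolding sets_coord_alg
  by (induction A rule: sigma_sets.induct) (use assms(2) in auto)

lemma glue_vimage:
  assumes "A \<in> sets (coord_alg {..- 1})" and "B \<in> sets (coord_alg {int n..})"
  shows "glue -` (A \<inter> B) = A \<times> B"
proof -
  have "glue (x, y) \<in> A \<longleftrightarrow> x \<in> A" "glue (x, y) \<in> B \<longleftrightarrow> y \<in> B" for x y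
    by (rule coord_alg_cong[OF assms(1)], simp add: glue_def)
       (rule coord_alg_cong[OF assms(2)], simp add: glue_def)
  then show ?thesis by auto
qed

lemma measurable_glue:
  "glue \<in> measurable (coord_alg {..- 1} \<Otimes>\<^sub>M coord_alg {int n..}) (joint_alg n)"
  unfolding joint_alg_def
proof (rule measurable_measure_of)
  fix D :: "(int \<Rightarrow> 'a) set"
  assume "D \<in> {A \<inter> B | A B. A \<in> sets (coord_alg {..- 1}) \<and> B \<in> sets (coord_alg {int n..})}"
  then obtain A B where AB: "A \<in> sets (coord_alg {..- 1})" "B \<in> sets (coord_alg {int n..})"
    and D: "D = A \<inter> B" by blast
  show "glue -` D \<inter> space (coord_alg {..- 1} \<Otimes>\<^sub>M coord_alg {int n..})
      \<in> sets (coord_alg {..- 1} \<Otimes>\<^sub>M coord_alg {int n..})"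
    unfolding D glue_vimage[OF AB] using AB by (simp add: space_pair_measure)
qed (auto simp: space_pair_measure)

lemma emeasure_joint_product:
  assumes M: "prob_space M" "sets M = sets (coord_alg UNIV)"
    and AB: "A \<in> sets (coord_alg {..- 1})" "B \<in> sets (coord_alg {int n..})"
  shows "emeasure (joint_product n M) (A \<inter> B) = emeasure M A * emeasure M B"
proof -
  let ?M1 = "restr_to_subalg M (coord_alg {..- 1})"
  let ?M2 = "restr_to_subalg M (coord_alg {int n..})"
  note sub = subalgebra_coord_alg[OF M(2)]
  have s: "sets ?M1 = sets (coord_alg {..- 1})" "sets ?M2 = sets (coord_alg {int n..})"
    using sets_restr_to_subalg[OF sub] by auto
  interpret M: prob_space M by (rule M(1))
  interpret M2: prob_space ?M2 by (rule prob_space_restr_to_subalg[OF sub M(1)])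
  have sp: "space (?M1 \<Otimes>\<^sub>M ?M2) = UNIV"
    using sets_eq_imp_space_eq[OF M(2)] by (simp add: space_pair_measure space_restr_to_subalg)
  have "A \<inter> B \<in> sets (joint_alg n)"
    unfolding sets_joint_alg using AB by (blast intro: sigma_sets.Basic)
  moreover have "glue \<in> measurable (?M1 \<Otimes>\<^sub>M ?M2) (joint_alg n)"
    using measurable_glue[of n] measurable_cong_sets[OF sets_pair_measure_cong[OF s] refl]
    by blast
  ultimately have "emeasure (joint_product n M) (A \<inter> B) = emeasure (?M1 \<Otimes>\<^sub>M ?M2) (A \<times> B)"
    unfolding joint_product_def by (simp add: emeasure_distr sp glue_vimage[OF AB] del: vimage_Int)
  also have "\<dots> = emeasure ?M1 A * emeasure ?M2 B"
    using AB s by (intro M2.emeasure_pair_measure_Times) auto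
  also have "\<dots> = emeasure M A * emeasure M B"
    using AB by (simp add: emeasure_restr_to_subalg[OF sub])
  finally show ?thesis .
qed

end

theory Submission
  imports Defs "HOL-Complex_Analysis.Great_Picard"
begin

text \<open>
  Let \<open>P\<^sup>x\<close> be the process started from the past \<open>x\<close>. Every \<open>P\<close> that follows \<open>g\<close> from time \<open>0\<close> on is the
  mixture of the \<open>P\<^sup>x\<close> over its own past, so by dynamic uniqueness all such \<open>P\<close> agree on tail events.
  Two probability measures that agree on the intersection of a decreasing sequence of \<open>\<sigma>\<close>-algebras are
  uniformly close on these \<open>\<sigma>\<close>-algebras in the limit. This is used three times. With stationarity it gives
  uniqueness of the \<open>g\<close>-measure. Comparing \<open>P\<^sup>x\<close> with its shift, it shows that every subsequential limit
  of the law of the past at time \<open>n\<close> under \<open>P\<^sup>x\<close> is invariant; continuity of \<open>g\<close> turns it into a \<open>g\<close>-measure.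
  Finally, it is applied to a \<open>g\<close>-measure and the independent gluing of its past and future on the joint
  algebras: an event in all joint algebras has tail events as its sections over the past, and these
  have the same measure under every \<open>P\<^sup>x\<close>.
\<close>

abbreviation streamS :: "'s stream measure" where
  "streamS \<equiv> stream_space (count_space UNIV)"

lemma in_sstart_UNIV: "s \<in> sstart UNIV w \<longleftrightarrow> (\<forall>i<length w. s !! i = w ! i)"
  by (rule sstart_eq) simp

section \<open>Measures on streams with prescribed cylinder probabilities\<close>

text \<open>\<open>Y\<close> labels each node of the tree of finite words with a letter; this is the
  node at depth \<open>n\<close> on the branch that obeys the labels.\<close>

primrec tree_word :: "('s list \<Rightarrow> 's) \<Rightarrow> nat \<Rightarrow> 's list" where
  "tree_word Y 0 = []"
| "tree_word Y (Suc n) = tree_word Y n @ [Y (tree_word Y n)]"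

text \<open>Either alternative gives the induction step, because by induction the node at depth
  \<open>i\<close> is the prefix \<open>take i w\<close>. Both directions of
  \<open>tree_word_in_sstart\<close> rest on this.\<close>

lemma tree_word_eq_take:
  assumes "n \<le> length w"
    and "(\<forall>i<n. Y (tree_word Y i) = w ! i) \<or> (\<forall>i<n. Y (take i w) = w ! i)"
  shows "tree_word Y n = take n w"
  using assms
proof (induction n)
  case (Suc n)
  then have "tree_word Y n = take n w" by auto
  with Suc.prems show ?case by (auto simp: take_Suc_conv_app_nth)
qed simp

text \<open>The right side looks up labels at fixed nodes, not at nodes that depend on
  \<open>Y\<close>. The cylinder thus becomes a product event in finitely many coordinates.\<close>

lemma tree_word_in_sstart:
  "to_stream (\<lambda>n. Y (tree_word Y n)) \<in> sstart UNIV w \<longleftrightarrow> (\<forall>i<length w. Y (take i w) = w ! i)"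
proof -
  have "Y (tree_word Y i) = Y (take i w)"
    if "(\<forall>i<length w. Y (tree_word Y i) = w ! i) \<or> (\<forall>i<length w. Y (take i w) = w ! i)" "i < length w" for i
    using tree_word_eq_take[of i w Y] that by auto
  then show ?thesis
    unfolding in_sstart_UNIV by (auto simp: to_stream_def)
qed

text \<open>
  Attaching an independent random letter, distributed according to the conditional weights of \<open>c\<close>,
  to every word yields a random stream by always appending the letter attached to the current word.
\<close>

lemma ex_stream_measure:
  fixes c :: "'s::finite list \<Rightarrow> real"
  assumes nonneg: "\<And>w. 0 \<le> c w" and Nil: "c [] = 1"
    and consistent: "\<And>w. (\<Sum>a\<in>UNIV. c (w @ [a])) = c w"
  shows "\<exists>M. prob_space M \<and> sets M = sets streamS \<and> (\<forall>w. measure M (sstart UNIV w) = c w)"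
proof -
  have c0: "c (w @ [a]) = 0" if "c w = 0" for w a
    using consistent[of w] that nonneg by (simp add: sum_nonneg_eq_0_iff)
  \<comment> \<open>A word of weight zero has no conditional weights, but its extensions have weight
    zero too by \<open>c0\<close>, so any distribution serves there. Hence the equation without
    division.\<close>
  have "\<exists>p :: 's pmf. \<forall>a. c w * pmf p a = c (w @ [a])" for w
  proof (cases "c w = 0")
    case False
    let ?f = "\<lambda>a. c (w @ [a]) / c w"
    have "(\<integral>\<^sup>+a. ennreal (?f a) \<partial>count_space UNIV) = 1"
      using False by (simp add: nn_integral_count_space_finite nonneg sum_divide_distrib[symmetric] consistent)
    then have "pmf (embed_pmf ?f) a = ?f a" for a
      by (intro pmf_embed_pmf) (auto intro: nonneg divide_nonneg_nonneg)
    with False show ?thesis by (intro exI[of _ "embed_pmf ?f"]) simp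
  qed (simp add: c0)
  then obtain k :: "'s list \<Rightarrow> 's pmf" where k: "\<And>w a. c w * pmf (k w) a = c (w @ [a])"
    by metis
  interpret product_prob_space "\<lambda>w. measure_pmf (k w)" UNIV
    by standard
  let ?\<Omega> = "PiM UNIV (\<lambda>w. measure_pmf (k w))"
  let ?X = "\<lambda>Y. to_stream (\<lambda>n. Y (tree_word Y n))"
  let ?J = "\<lambda>w::'s list. (\<lambda>i. take i w) ` {..<length w}"
  \<comment> \<open>The nodes in \<open>?J w\<close> are the proper prefixes \<open>v\<close> of
    \<open>w\<close>, and \<open>w ! length v\<close> is the letter that follows \<open>v\<close> in
    \<open>w\<close>.\<close>
  have vim: "?X -` sstart UNIV w \<inter> space ?\<Omega>
      = prod_emb UNIV (\<lambda>w. measure_pmf (k w)) (?J w) (PiE (?J w) (\<lambda>v. {w ! length v}))" for w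
    by (auto simp: tree_word_in_sstart prod_emb_def space_PiM PiE_iff)
  have meas: "?X \<in> measurable ?\<Omega> streamS"
  proof (rule measurable_stream_space2)
    fix n
    have "(\<lambda>Y. ?X Y !! n) -` {a} \<inter> space ?\<Omega> \<in> sets ?\<Omega>" for a
    proof -
      \<comment> \<open>Letter \<open>n\<close> is read at a random node, so the event is split by
        the first \<open>n + 1\<close> letters into events at fixed nodes.\<close>
      have "(\<lambda>Y. ?X Y !! n) -` {a} \<inter> space ?\<Omega>
          = (\<Union>w\<in>{w. length w = Suc n \<and> w ! n = a}. ?X -` sstart UNIV w \<inter> space ?\<Omega>)"
      proof (rule set_eqI, rule iffI)
        fix Y assume "Y \<in> (\<lambda>Y. ?X Y !! n) -` {a} \<inter> space ?\<Omega>"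
        then show "Y \<in> (\<Union>w\<in>{w. length w = Suc n \<and> w ! n = a}. ?X -` sstart UNIV w \<inter> space ?\<Omega>)"
          by (auto intro!: exI[of _ "stake (Suc n) (?X Y)"] simp: in_sstart_UNIV stake_nth simp del: stake.simps)
      next
        fix Y assume "Y \<in> (\<Union>w\<in>{w. length w = Suc n \<and> w ! n = a}. ?X -` sstart UNIV w \<inter> space ?\<Omega>)"
        then show "Y \<in> (\<lambda>Y. ?X Y !! n) -` {a} \<inter> space ?\<Omega>"
          by (auto simp: in_sstart_UNIV)
      qed
      also have "\<dots> \<in> sets ?\<Omega>"
        unfolding vim by (intro sets.countable_UN' countable_Collect sets_PiM_I) auto
      finally show ?thesis .
    qed
    then show "(\<lambda>Y. ?X Y !! n) \<in> measurable ?\<Omega> (count_space UNIV)"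
      by (intro measurable_count_space_eq2[THEN iffD2]) auto
  qed
  have prod: "c w = (\<Prod>i<length w. pmf (k (take i w)) (w ! i))" for w
  proof (induction w rule: rev_induct)
    case (snoc a w)
    then show ?case by (auto simp: k[symmetric] nth_append intro!: prod.cong)
  qed (simp add: Nil)
  have "measure ?\<Omega> (?X -` sstart UNIV w \<inter> space ?\<Omega>) = c w" for w
  proof -
    have inj: "inj_on (\<lambda>i. take i w) {..<length w}"
      by (rule inj_on_inverseI[where g=length]) simp
    have "emeasure ?\<Omega> (?X -` sstart UNIV w \<inter> space ?\<Omega>)
        = (\<Prod>v\<in>?J w. emeasure (measure_pmf (k v)) {w ! length v})"
      unfolding vim by (rule emeasure_PiM_emb) auto
    also have "\<dots> = ennreal (c w)"
      by (subst prod.reindex[OF inj]) (simp add: prod emeasure_pmf_single prod_ennreal)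
    finally show ?thesis
      by (simp add: measure_def nonneg)
  qed
  then show ?thesis
    using meas by (intro exI[of _ "distr ?\<Omega> streamS ?X"])
      (auto intro!: P.prob_space_distr simp: measure_distr sstart_sets)
qed

section \<open>Pasts and filtrations\<close>

lemma past_nth [simp]: "past j x !! k = x (j - int k)"
  by (simp add: past_def to_stream_def)

lemma past_Stream: "past j x = x j ## past (j - 1) x"
proof -
  have "(\<lambda>k. x (j - int k)) = case_nat (x j) (\<lambda>k. x (j - 1 - int k))"
    by (auto simp: fun_eq_iff algebra_simps split: nat.split)
  then show ?thesis by (simp add: past_def to_stream_nat_case)
qed

lemma measurable_coord:
  "i \<in> I \<Longrightarrow> (\<lambda>z :: int \<Rightarrow> 's::finite. z i) \<in> measurable (coord_alg I) (count_space UNIV)"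
  by (auto simp: measurable_count_space_eq2 vimage_def sets_coord_alg intro: sigma_sets.Basic)

lemma measurable_past:
  assumes "{..j} \<subseteq> I"
  shows "(past j :: (int \<Rightarrow> 's::finite) \<Rightarrow> _) \<in> measurable (coord_alg I) streamS"
  using assms by (intro measurable_stream_space2) (auto intro!: measurable_coord)

lemma measurable_past_UNIV [measurable]:
  "(past j :: (int \<Rightarrow> 's::finite) \<Rightarrow> _) \<in> measurable (coord_alg UNIV) streamS"
  by (rule measurable_past) simp

lemma measurable_past_sets:
  "sets P = sets (coord_alg UNIV :: (int \<Rightarrow> 's::finite) measure) \<Longrightarrow> past j \<in> measurable P streamS"
  using measurable_past_UNIV measurable_cong_sets by blast

lemma past_eq_iff: "past j z = x \<longleftrightarrow> (\<forall>n. z (j - int n) = x !! n)"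
proof
  assume "\<forall>n. z (j - int n) = x !! n"
  then have "past j z = smap ((!!) x) nats" by (simp add: past_def to_stream_def)
  then show "past j z = x" by (simp add: stream_smap_nats[symmetric])
qed auto

text \<open>The preimages form a sigma-algebra, and the coordinate at \<open>i \<le> j\<close> is
  entry \<open>j - i\<close> of the past. Events up to time \<open>j\<close> thereby become events
  of a single stream.\<close>

lemma sets_coord_alg_atMost:
  "sets (coord_alg {..j} :: (int \<Rightarrow> 's::finite) measure) = {past j -` B | B. B \<in> sets streamS}"
proof (intro set_eqI iffI)
  fix A :: "(int \<Rightarrow> 's) set"
  assume "A \<in> {past j -` B | B. B \<in> sets streamS}"
  then show "A \<in> sets (coord_alg {..j})"
    using measurable_sets[OF measurable_past[of j "{..j}"]] by auto
next
  fix A :: "(int \<Rightarrow> 's) set"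
  assume "A \<in> sets (coord_alg {..j})"
  then show "A \<in> {past j -` B | B. B \<in> sets streamS}"
    unfolding sets_coord_alg
  proof (induction A rule: sigma_sets.induct)
    case (Basic A)
    then obtain i a where "i \<le> j" and A: "A = {x. x i = a}" by auto
    moreover have "{s \<in> space streamS. s !! nat (j - i) = a} \<in> sets streamS" by measurable
    then have "{s. s !! nat (j - i) = a} \<in> sets streamS" by (simp add: space_stream_space)
    ultimately show ?case
      by (auto intro!: exI[of _ "{s. s !! nat (j - i) = a}"])
  next
    case Empty
    show ?case by (auto intro!: exI[of _ "{}"])
  next
    case (Compl A)
    then obtain B where "B \<in> sets streamS" "A = past j -` B" by auto
    then show ?case
      by (auto intro!: exI[of _ "space streamS - B"] simp: space_stream_space)
  next
    case (Union A)
    then have "\<forall>i. \<exists>B. A i = past j -` B \<and> B \<in> sets streamS" by auto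
    then obtain B where "\<And>i. A i = past j -` B i" "\<And>i. B i \<in> sets streamS" by metis
    then show ?case
      by (auto intro!: exI[of _ "\<Union>i. B i"])
  qed
qed

section \<open>Exhausting filtrations and equality of measures\<close>

lemma coord_alg_mono: "I \<subseteq> J \<Longrightarrow> sets (coord_alg I) \<subseteq> sets (coord_alg J)"
  unfolding sets_coord_alg by (rule sigma_sets_mono') auto

text \<open>For increasing \<open>I\<close> with union \<open>UNIV\<close> this is an
  intersection-stable generator of the full algebra. It serves both for equality of measures and for
  measurability of \<open>chain\<close>.\<close>

definition filtration_events :: "(nat \<Rightarrow> int set) \<Rightarrow> (int \<Rightarrow> 's) set set" where
  "filtration_events I = (\<Union>n. sets (coord_alg (I n)))"

lemma Int_stable_filtration_events:
  assumes "incseq I"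
  shows "Int_stable (filtration_events I)"
proof (rule Int_stableI)
  fix A B :: "(int \<Rightarrow> 'a) set"
  assume "A \<in> filtration_events I" "B \<in> filtration_events I"
  then obtain m n where "A \<in> sets (coord_alg (I m))" "B \<in> sets (coord_alg (I n))"
    unfolding filtration_events_def by auto
  then have "A \<in> sets (coord_alg (I (max m n)))" "B \<in> sets (coord_alg (I (max m n)))"
    by (meson coord_alg_mono incseqD[OF assms] max.cobounded1 max.cobounded2 subsetD)+
  then show "A \<inter> B \<in> filtration_events I"
    unfolding filtration_events_def by blast
qed

lemma sets_coord_alg_UNIV_filtration_events:
  assumes "(\<Union>n. I n) = UNIV"
  shows "sets (coord_alg UNIV) = sigma_sets UNIV (filtration_events I)"
proof
  have "{x. x i = a} \<in> filtration_events I" for i a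
  proof -
    from assms obtain n where "i \<in> I n" by blast
    then have "{x. x i = a} \<in> sets (coord_alg (I n))"
      unfolding sets_coord_alg by (intro sigma_sets.Basic CollectI exI[of _ i] exI[of _ a]) auto
    then show ?thesis
      unfolding filtration_events_def by blast
  qed
  then show "sets (coord_alg UNIV) \<subseteq> sigma_sets UNIV (filtration_events I)"
    unfolding sets_coord_alg by (intro sigma_sets_mono') auto
  have "filtration_events I \<subseteq> sets (coord_alg UNIV)"
    unfolding filtration_events_def by (auto dest: coord_alg_mono[OF subset_UNIV, THEN subsetD])
  then show "sigma_sets UNIV (filtration_events I) \<subseteq> sets (coord_alg UNIV)"
    using sets.sigma_sets_subset[of "filtration_events I" "coord_alg UNIV"] by simp
qed

lemma prob_eqI_filtration:
  assumes I: "incseq I" "(\<Union>n. I n) = UNIV"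
    and "prob_space P"
    and sets: "sets P = sets (coord_alg UNIV)" "sets Q = sets (coord_alg UNIV)"
    and eq: "\<And>n A. A \<in> sets (coord_alg (I n)) \<Longrightarrow> emeasure P A = emeasure Q A"
  shows "P = Q"
proof (rule measure_eqI_generator_eq[OF Int_stable_filtration_events[OF I(1)], where \<Omega>=UNIV and A="\<lambda>_. UNIV"])
  interpret P: prob_space P by fact
  show "emeasure P UNIV \<noteq> \<infinity>" by simp
  have "UNIV \<in> filtration_events I"
    unfolding filtration_events_def using sets.top[of "coord_alg (I 0)"]
    by (simp only: space_coord_alg) blast
  then show "range (\<lambda>_. UNIV) \<subseteq> filtration_events I" by blast
  show "emeasure P X = emeasure Q X" if "X \<in> filtration_events I" for X
    using that eq by (auto simp: filtration_events_def)
qed (auto simp: sets sets_coord_alg_UNIV_filtration_events[OF I(2)])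

text \<open>Level \<open>n\<close> ends at time \<open>n - 1\<close>, so that level zero is the
  initial past and \<open>n\<close> counts the letters drawn since.\<close>

lemma past_filtration: "incseq (\<lambda>n. {..int n - 1})" "(\<Union>n. {..int n - 1}) = UNIV"
proof -
  show "(\<Union>n. {..int n - 1}) = UNIV"
  proof (intro equalityI subsetI UN_I)
    fix i :: int show "i \<in> {..int (nat (i + 1)) - 1}" by auto
  qed auto
qed (auto simp: incseq_def)

lemma prob_eqI_past:
  assumes P: "prob_space P" "sets P = sets (coord_alg UNIV :: (int \<Rightarrow> 's::finite) measure)"
    "sets Q = sets (coord_alg UNIV)"
    and eq: "\<And>n B. B \<in> sets streamS \<Longrightarrow>
      emeasure P (past (int n - 1) -` B) = emeasure Q (past (int n - 1) -` B)"
  shows "P = Q"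
  by (rule prob_eqI_filtration[OF past_filtration P]) (auto simp: sets_coord_alg_atMost eq)

section \<open>The transfer operator\<close>

text \<open>The Ruelle operator of \<open>g\<close>: the expectation of \<open>f\<close> after one
  letter drawn from \<open>g\<close> has been put in front of the past \<open>s\<close>.\<close>

definition transfer :: "('s::finite stream \<Rightarrow> real) \<Rightarrow> ('s stream \<Rightarrow> real) \<Rightarrow> 's stream \<Rightarrow> real" where
  "transfer g f s = (\<Sum>a\<in>UNIV. g (a ## s) * f (a ## s))"

lemma kernelD:
  assumes "kernel g"
  shows "g \<in> borel_measurable streamS" "0 \<le> g s" "g s \<le> 1" "(\<Sum>a\<in>UNIV. g (a ## s)) = 1"
  using assms by (auto simp: kernel_def)

lemma borel_measurable_transfer:
  assumes "kernel g" "f \<in> borel_measurable streamS"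
  shows "transfer g f \<in> borel_measurable streamS"
proof -
  note [measurable] = kernelD(1)[OF assms(1)] assms(2)
  show ?thesis unfolding transfer_def by measurable
qed

lemma transfer_bounded:
  assumes "kernel g" "\<And>s. \<bar>f s\<bar> \<le> C"
  shows "\<bar>transfer g f s\<bar> \<le> C"
proof -
  have "\<bar>transfer g f s\<bar> \<le> (\<Sum>a\<in>UNIV. g (a ## s) * C)"
    unfolding transfer_def using assms(2) kernelD(2)[OF assms(1)]
    by (intro order_trans[OF sum_abs] sum_mono) (auto simp: abs_mult intro!: mult_left_mono)
  also have "\<dots> = C"
    by (simp add: sum_distrib_right[symmetric] kernelD(4)[OF assms(1)])
  finally show ?thesis .
qed

lemma iterated_transfer:
  assumes "kernel g" "f \<in> borel_measurable streamS" "\<And>s. \<bar>f s\<bar> \<le> C"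
  shows borel_measurable_iterated_transfer: "(transfer g ^^ n) f \<in> borel_measurable streamS"
    and iterated_transfer_bounded: "\<bar>(transfer g ^^ n) f s\<bar> \<le> C"
proof -
  have "(transfer g ^^ n) f \<in> borel_measurable streamS \<and> (\<forall>s. \<bar>(transfer g ^^ n) f s\<bar> \<le> C)"
    by (induction n)
      (auto simp: assms intro: borel_measurable_transfer[OF assms(1)] transfer_bounded[OF assms(1)])
  then show "(transfer g ^^ n) f \<in> borel_measurable streamS" "\<bar>(transfer g ^^ n) f s\<bar> \<le> C" by auto
qed

section \<open>The conditional law at one time as an integral identity\<close>

context
  fixes g :: "'s::finite stream \<Rightarrow> real" and P :: "(int \<Rightarrow> 's) measure" and j :: int
  assumes g: "kernel g" and P: "prob_space P" "sets P = sets (coord_alg UNIV)"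
begin

interpretation P: prob_space P by (rule P)

interpretation F: finite_measure_subalgebra P "coord_alg {..j - 1}"
  by unfold_locales (rule subalgebra_coord_alg[OF P(2)])

lemmas [measurable] = measurable_past_sets[OF P(2)]

text \<open>Split by the letter \<open>a\<close> at time \<open>j\<close>. On each piece the factor
  \<open>f (a ## past (j - 1) z)\<close> is known before time \<open>j\<close>, so the indicator of
  the letter may be replaced by its conditional expectation, which is \<open>g\<close>.\<close>

lemma follows_kernel_at_integral:
  assumes fol: "follows_kernel_at j g P"
    and f[measurable]: "f \<in> borel_measurable streamS" and bd: "\<And>s. \<bar>f s\<bar> \<le> C"
  shows "(\<integral>z. f (past j z) \<partial>P) = (\<integral>z. transfer g f (past (j - 1) z) \<partial>P)"
proof -
  note [measurable] = kernelD(1)[OF g]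
  have [measurable]: "(\<lambda>z. z j) \<in> measurable P (count_space UNIV)"
    using measurable_coord[of j UNIV] measurable_cong_sets[OF P(2) refl] by blast
  have ind[measurable]: "(indicator {x. x j = a} :: _ \<Rightarrow> real) \<in> borel_measurable P" for a
    by measurable
  have fa: "(\<lambda>z. f (a ## past (j - 1) z)) \<in> borel_measurable (coord_alg {..j - 1})" for a
    by (rule measurable_compose[OF measurable_past[of "j - 1"]]) auto
  have int1: "integrable P (\<lambda>z. f (a ## past (j - 1) z) * indicator {x. x j = a} z)" for a
    by (rule P.integrable_const_bound[where B=C])
       (use bd order_trans[OF abs_ge_zero bd] in \<open>auto simp: abs_mult indicator_def\<close>)
  have int2: "integrable P (\<lambda>z. g (a ## past (j - 1) z) * f (a ## past (j - 1) z))" for a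
    using bd kernelD(2,3)[OF g] mult_mono[of "g _" 1 "\<bar>f _\<bar>" C]
    by (intro P.integrable_const_bound[where B=C]) (auto simp: abs_mult)
  have step: "(\<integral>z. f (a ## past (j - 1) z) * indicator {x. x j = a} z \<partial>P)
      = (\<integral>z. g (a ## past (j - 1) z) * f (a ## past (j - 1) z) \<partial>P)" for a
  proof -
    have "(\<integral>z. f (a ## past (j - 1) z) * indicator {x. x j = a} z \<partial>P)
      = (\<integral>z. f (a ## past (j - 1) z) * real_cond_exp P (coord_alg {..j - 1}) (indicator {x. x j = a}) z \<partial>P)"
      by (rule F.real_cond_exp_intg(2)[symmetric, OF int1 fa ind])
    also have "\<dots> = (\<integral>z. g (a ## past (j - 1) z) * f (a ## past (j - 1) z) \<partial>P)"
      using fol[unfolded follows_kernel_at_def, rule_format, of a]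
        borel_measurable_cond_exp2[of P "coord_alg {..j - 1}"]
      by (intro integral_cong_AE) (auto intro!: borel_measurable_times elim!: eventually_mono)
    finally show ?thesis .
  qed
  have "f (past j z) = (\<Sum>a\<in>UNIV. f (a ## past (j - 1) z) * indicator {x. x j = a} z)" for z
    by (simp add: past_Stream[of j] indicator_def if_distrib[of "\<lambda>x. _ * x"] sum.delta cong: if_cong)
  then show ?thesis
    unfolding transfer_def by (simp only: Bochner_Integration.integral_sum int1 int2 step)
qed

text \<open>Indicators suffice: an event of the past before \<open>j\<close> together with the
  letter \<open>a\<close> at time \<open>j\<close> is an event of \<open>past j\<close>, and the
  transfer of its indicator is the indicator of the former times \<open>g\<close>. This is the
  defining property of conditional expectation.\<close>

lemma follows_kernel_atI:
  assumes eq: "\<And>B. B \<in> sets streamS \<Longrightarrow>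
      (\<integral>z. indicator B (past j z) \<partial>P) = (\<integral>z. transfer g (indicator B) (past (j - 1) z) \<partial>P)"
  shows "follows_kernel_at j g P"
  unfolding follows_kernel_at_def
proof
  fix a
  note [measurable] = kernelD(1)[OF g]
  have [measurable]: "(\<lambda>z. z j) \<in> measurable P (count_space UNIV)"
    using measurable_coord[of j UNIV] measurable_cong_sets[OF P(2) refl] by blast
  show "AE x in P. real_cond_exp P (coord_alg {..j - 1}) (indicator {x. x j = a}) x = g (a ## past (j - 1) x)"
  proof (rule F.real_cond_exp_charact)
    fix A :: "(int \<Rightarrow> 's) set" assume "A \<in> sets (coord_alg {..j - 1})"
    then obtain B where A: "A = past (j - 1) -` B" and B[measurable]: "B \<in> sets streamS"
      unfolding sets_coord_alg_atMost by auto
    let ?B = "{s. shd s = a \<and> stl s \<in> B}"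
    have "{s \<in> space streamS. shd s = a \<and> stl s \<in> B} \<in> sets streamS" by measurable
    then have "?B \<in> sets streamS" by (simp add: space_stream_space)
    moreover have "indicator ?B (past j z) = indicator A z *\<^sub>R (indicator {x. x j = a} z :: real)" for z
      by (auto simp: A past_Stream[of j] indicator_def)
    moreover have "transfer g (indicator ?B) (past (j - 1) z) = indicator A z *\<^sub>R g (a ## past (j - 1) z)" for z
    proof -
      have "transfer g (indicator ?B) s = indicator B s * g (a ## s)" for s
        unfolding transfer_def
        by (subst sum.remove[of _ a]) (auto simp: indicator_def intro!: sum.neutral)
      then show ?thesis by (simp add: A indicator_def)
    qed
    ultimately show "(LINT x:A|P. indicator {x. x j = a} x) = (LINT x:A|P. g (a ## past (j - 1) x))"
      using eq[of ?B] by (simp add: set_lebesgue_integral_def)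
  next
    show "integrable P (indicator {x. x j = a} :: _ \<Rightarrow> real)"
      by (rule P.integrable_const_bound[where B=1]) auto
    show "integrable P (\<lambda>x. g (a ## past (j - 1) x))"
      by (rule P.integrable_const_bound[where B=1]) (use kernelD(2,3)[OF g] in auto)
    show "(\<lambda>x. g (a ## past (j - 1) x)) \<in> borel_measurable (coord_alg {..j - 1})"
      by (rule measurable_compose[OF measurable_past[of "j - 1"]]) auto
  qed
qed

end

text \<open>The latest letter is integrated out first. This replaces \<open>f\<close> by its
  transfer, so the induction ranges over all bounded \<open>f\<close>.\<close>

lemma follows_kernel_integral_iterated:
  assumes g: "kernel g" and P: "prob_space P" "sets P = sets (coord_alg UNIV)"
    and fol: "\<forall>j\<ge>0. follows_kernel_at j g P"
    and f: "f \<in> borel_measurable streamS" "\<And>s. \<bar>f s\<bar> \<le> C"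
  shows "(\<integral>z. f (past (int n - 1) z) \<partial>P) = (\<integral>z. (transfer g ^^ n) f (past (- 1) z) \<partial>P)"
  using f
proof (induction n arbitrary: f)
  case (Suc n)
  have "(\<integral>z. f (past (int (Suc n) - 1) z) \<partial>P) = (\<integral>z. transfer g f (past (int n - 1) z) \<partial>P)"
    using follows_kernel_at_integral[OF g P _ Suc.prems, of "int n"] fol by simp
  also have "\<dots> = (\<integral>z. (transfer g ^^ n) (transfer g f) (past (- 1) z) \<partial>P)"
    by (rule Suc.IH[OF borel_measurable_transfer[OF g Suc.prems(1)] transfer_bounded[OF g Suc.prems(2)]])
  finally show ?case by (simp add: funpow_swap1)
qed simp

section \<open>The process started from a past\<close>

lemma measurable_to_coord_alg:
  assumes "\<And>i. i \<in> I \<Longrightarrow> (\<lambda>t. f t i) \<in> measurable M (count_space UNIV)"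
  shows "f \<in> measurable M (coord_alg I :: (int \<Rightarrow> 's::finite) measure)"
  unfolding coord_alg_def
proof (rule measurable_measure_of)
  fix A :: "(int \<Rightarrow> 's) set" assume "A \<in> {{x. x i = a} | i a. i \<in> I}"
  then obtain i a where "i \<in> I" and A: "A = {x. x i = a}" by auto
  from measurable_sets[OF assms[OF this(1)], of "{a}"]
  show "f -` A \<inter> space M \<in> sets M" unfolding A by (simp add: vimage_def)
qed auto

text \<open>The probability that the letters following the past \<open>x\<close> are
  \<open>w\<close>. Here \<open>w\<close> is in the order of time, against the convention for pasts,
  so the past after \<open>w\<close> is \<open>rev w @- x\<close>.\<close>

primrec word_weight :: "('s::finite stream \<Rightarrow> real) \<Rightarrow> 's list \<Rightarrow> 's stream \<Rightarrow> real" where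
  "word_weight g [] x = 1"
| "word_weight g (a # w) x = g (a ## x) * word_weight g w (a ## x)"

lemma word_weight_snoc: "word_weight g (w @ [a]) x = word_weight g w x * g (a ## rev w @- x)"
  by (induction w arbitrary: x) auto

lemma word_weight_nonneg: "kernel g \<Longrightarrow> 0 \<le> word_weight g w x"
  by (induction w arbitrary: x) (auto simp: kernelD)

lemma finite_words [simp]: "finite {w :: 's::finite list. length w = n}"
  using finite_lists_length_eq[of "UNIV :: 's set" n] by simp

lemma sum_words_Suc:
  fixes f :: "'s::finite list \<Rightarrow> real"
  shows "(\<Sum>w | length w = Suc n. f w) = (\<Sum>a\<in>UNIV. \<Sum>w | length w = n. f (a # w))"
proof -
  have "bij_betw (\<lambda>(a, w). a # w) (UNIV \<times> {w :: 's list. length w = n}) {w. length w = Suc n}"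
    by (rule bij_betw_byWitness[where f'="\<lambda>w. (hd w, tl w)"]) (auto simp: length_Suc_conv)
  then show ?thesis
    by (simp add: sum.reindex_bij_betw[symmetric] sum.cartesian_product split_def)
qed

text \<open>The outermost transfer draws the first letter of \<open>w\<close>. In this form the
  iterates can be compared with cylinder probabilities.\<close>

lemma iterated_transfer_eq:
  "(transfer g ^^ n) f x = (\<Sum>w | length w = n. word_weight g w x * f (rev w @- x))"
proof (induction n arbitrary: x)
  case (Suc n)
  show ?case
    by (simp add: sum_words_Suc transfer_def[of g "(transfer g ^^ n) f"] Suc.IH sum_distrib_left mult.assoc)
qed simp

text \<open>A function of the first \<open>n\<close> letters is a finite combination of cylinder
  indicators. This is used to integrate over \<open>future\<close>, and again for the passage to a
  limit of cylinder probabilities.\<close>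

lemma integral_stake:
  fixes F :: "'s::finite list \<Rightarrow> real"
  assumes N: "prob_space N" "sets N = sets streamS"
  shows "(\<integral>s. F (stake n s) \<partial>N) = (\<Sum>w | length w = n. F w * measure N (sstart UNIV w))"
proof -
  interpret N: prob_space N by fact
  have ev: "sstart UNIV w \<in> sets N" for w :: "'s list"
    by (simp add: N(2) sstart_sets)
  have "F (stake n s) = (\<Sum>w | length w = n. F w * indicator (sstart UNIV w) s)" for s
  proof -
    have "s \<in> sstart UNIV w \<longleftrightarrow> w = stake n s" if "length w = n" for w
      using that by (auto simp: in_sstart_UNIV list_eq_iff_nth_eq stake_nth)
    then have "(\<Sum>w | length w = n. F w * indicator (sstart UNIV w) s)
        = (\<Sum>w | length w = n. if w = stake n s then F w else 0)"
      by (intro sum.cong) (auto simp: indicator_def)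
    then show ?thesis by (simp add: sum.delta)
  qed
  then have "(\<integral>s. F (stake n s) \<partial>N) = (\<integral>s. (\<Sum>w | length w = n. F w * indicator (sstart UNIV w) s) \<partial>N)"
    by simp
  also have "\<dots> = (\<Sum>w | length w = n. F w * measure N (sstart UNIV w))"
    using ev by (subst Bochner_Integration.integral_sum)
      (auto simp: less_top[symmetric] intro!: integrable_mult_right integrable_real_indicator)
  finally show ?thesis .
qed

text \<open>The law of the letters at times 0, 1, and so on after the past \<open>x\<close>.
  \<open>SOME\<close> picks a measure whose existence comes from
  \<open>ex_stream_measure\<close>.\<close>

definition future :: "('s::finite stream \<Rightarrow> real) \<Rightarrow> 's stream \<Rightarrow> 's stream measure" where
  "future g x = (SOME M. prob_space M \<and> sets M = sets streamS \<and>
     (\<forall>w. measure M (sstart UNIV w) = word_weight g w x))"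

lemma future:
  assumes "kernel g"
  shows "prob_space (future g x)" "sets (future g x) = sets streamS"
    "measure (future g x) (sstart UNIV w) = word_weight g w x"
proof -
  have "\<exists>M. prob_space M \<and> sets M = sets streamS \<and> (\<forall>w. measure M (sstart UNIV w) = word_weight g w x)"
    by (rule ex_stream_measure)
      (auto simp: word_weight_nonneg assms word_weight_snoc sum_distrib_left[symmetric] kernelD(4))
  from someI_ex[OF this, folded future_def]
  show "prob_space (future g x)" "sets (future g x) = sets streamS"
    "measure (future g x) (sstart UNIV w) = word_weight g w x" by auto
qed

text \<open>The head of \<open>t\<close> sits at time 0 and the head of \<open>x\<close> at time -1,
  so \<open>t\<close> is read forwards and \<open>x\<close> backwards.\<close>

definition join :: "'s stream \<Rightarrow> 's stream \<Rightarrow> int \<Rightarrow> 's" where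
  "join x t = (\<lambda>i. if 0 \<le> i then t !! nat i else x !! nat (- i - 1))"

lemma past_join: "past (int n - 1) (join x t) = rev (stake n t) @- x"
proof (induction n)
  case 0
  have "past (- 1) (join x t) = to_stream ((!!) x)"
    by (simp add: past_def join_def)
  then show ?case by (simp add: to_stream_def stream_smap_nats[symmetric])
next
  case (Suc n)
  then show ?case
    by (simp add: past_Stream[of "int n"] join_def stake_Suc del: stake.simps)
qed

lemma measurable_join: "join x \<in> measurable streamS (coord_alg UNIV :: (int \<Rightarrow> 's::finite) measure)"
proof (rule measurable_to_coord_alg)
  fix i show "(\<lambda>t. join x t i) \<in> measurable streamS (count_space UNIV)"
    by (cases "0 \<le> i") (simp_all add: join_def)
qed

text \<open>This is the measure \<open>P\<^sup>x\<close>.\<close>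

definition chain :: "('s::finite stream \<Rightarrow> real) \<Rightarrow> 's stream \<Rightarrow> (int \<Rightarrow> 's) measure" where
  "chain g x = distr (future g x) (coord_alg UNIV) (join x)"

lemma sets_chain [simp]: "sets (chain g x) = sets (coord_alg UNIV)"
  by (simp add: chain_def)

context
  fixes g :: "'s::finite stream \<Rightarrow> real"
  assumes g: "kernel g"
begin

lemma measurable_join_future [measurable]: "join x \<in> measurable (future g x) (coord_alg UNIV)"
  using measurable_join[of x] measurable_cong_sets[OF future(2)[OF g] refl] by blast

lemma prob_space_chain: "prob_space (chain g x)"
  unfolding chain_def by (intro prob_space.prob_space_distr future(1)[OF g] measurable_join_future)

lemma integral_chain:
  fixes f :: "'s stream \<Rightarrow> real"
  assumes f[measurable]: "f \<in> borel_measurable streamS"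
  shows "(\<integral>z. f (past (int n - 1) z) \<partial>chain g x) = (transfer g ^^ n) f x"
proof -
  have "(\<integral>z. f (past (int n - 1) z) \<partial>chain g x) = (\<integral>t. f (rev (stake n t) @- x) \<partial>future g x)"
    unfolding chain_def by (subst integral_distr) (auto simp: past_join)
  also have "\<dots> = (\<Sum>w | length w = n. f (rev w @- x) * measure (future g x) (sstart UNIV w))"
    by (rule integral_stake[OF future(1,2)[OF g]])
  finally show ?thesis
    by (simp add: iterated_transfer_eq future(3)[OF g] mult.commute)
qed

lemma emeasure_chain_past:
  assumes "B \<in> sets streamS"
  shows "emeasure (chain g x) (past (int n - 1) -` B) = ennreal ((transfer g ^^ n) (indicator B) x)"
proof -
  interpret prob_space "chain g x" by (rule prob_space_chain)
  have "past (int n - 1) -` B \<in> sets (chain g x)"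
    using measurable_sets[OF measurable_past_UNIV assms, of "int n - 1"] by simp
  moreover have "(indicator B (past (int n - 1) z) :: real) = indicator (past (int n - 1) -` B) z" for z
    by (simp add: indicator_def)
  ultimately show ?thesis
    using integral_chain[of "indicator B" x n] assms by (simp add: emeasure_eq_measure)
qed

lemma chain_past_AE: "AE z in chain g x. past (- 1) z = x"
proof -
  have x: "past (- 1) (join x t) = x" for t
    using past_join[of 0 x t] by simp
  have "{z. past (- 1) z = x} = (\<Inter>n. {z. z (- 1 - int n) = x !! n})"
    by (auto simp: past_eq_iff)
  also have "\<dots> \<in> sets (coord_alg UNIV)"
    using sets.top[of "coord_alg UNIV"] unfolding space_coord_alg
    by (rule sets.countable_INT'') (auto simp: sets_coord_alg intro: sigma_sets.Basic)
  finally show ?thesis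
    unfolding chain_def by (subst AE_distr_iff) (auto simp: x)
qed

text \<open>At time \<open>n\<close> both sides of the criterion \<open>follows_kernel_atI\<close>
  are, by \<open>integral_chain\<close>, the transfer of the indicator iterated \<open>n + 1\<close>
  times and evaluated at \<open>x\<close>.\<close>

lemma started_from_chain: "started_from g x (chain g x)"
  unfolding started_from_def
proof (intro conjI allI impI prob_space_chain sets_chain chain_past_AE)
  fix j :: int assume "0 \<le> j"
  then obtain n where j: "j = int n" using nonneg_int_cases by blast
  show "follows_kernel_at j g (chain g x)"
  proof (rule follows_kernel_atI[OF g prob_space_chain sets_chain])
    fix B :: "'s stream set" assume B: "B \<in> sets streamS"
    show "(\<integral>z. indicator B (past j z) \<partial>chain g x) = (\<integral>z. transfer g (indicator B) (past (j - 1) z) \<partial>chain g x)"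
      using integral_chain[of "indicator B" x "Suc n"] B
        integral_chain[of "transfer g (indicator B)" x n] borel_measurable_transfer[OF g, of "indicator B"]
      by (simp add: j funpow_swap1)
  qed
qed

text \<open>It suffices to test the events of the filtration, and their probabilities are iterated
  transfers, which are measurable in the starting past.\<close>

lemma measurable_chain [measurable]: "chain g \<in> measurable streamS (prob_algebra (coord_alg UNIV))"
proof (rule measurable_prob_algebra_generated[OF sets_coord_alg_UNIV_filtration_events[OF past_filtration(2)]
      Int_stable_filtration_events[OF past_filtration(1)]])
  fix A :: "(int \<Rightarrow> 's) set" assume "A \<in> filtration_events (\<lambda>n. {..int n - 1})"
  then obtain n B where A: "A = past (int n - 1) -` B" and B: "B \<in> sets streamS"
    unfolding filtration_events_def sets_coord_alg_atMost by auto
  have "(transfer g ^^ n) (indicator B) \<in> borel_measurable streamS"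
    using B by (intro borel_measurable_iterated_transfer[OF g, where C=1]) auto
  then show "(\<lambda>a. emeasure (chain g a) A) \<in> borel_measurable streamS"
    unfolding A emeasure_chain_past[OF B] by simp
qed (auto simp: prob_space_chain)

lemma integral_bind_chain:
  fixes f :: "'s stream \<Rightarrow> real"
  assumes N: "prob_space N" "sets N = sets streamS"
    and f: "f \<in> borel_measurable streamS" "\<And>s. \<bar>f s\<bar> \<le> C"
  shows "(\<integral>z. f (past (int n - 1) z) \<partial>(N \<bind> chain g)) = (\<integral>s. (transfer g ^^ n) f s \<partial>N)"
proof -
  interpret N: prob_space N by fact
  have K: "chain g \<in> measurable N (subprob_algebra (coord_alg UNIV))"
    using measurable_prob_algebraD[OF measurable_chain] measurable_cong_sets[OF N(2) refl] by blast
  note [measurable] = f(1)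
  have "(\<integral>z. f (past (int n - 1) z) \<partial>(N \<bind> chain g)) = (\<integral>s. \<integral>z. f (past (int n - 1) z) \<partial>chain g s \<partial>N)"
    by (rule integral_bind[where N="chain g" and K="coord_alg UNIV" and B'=1 and B=C])
      (use K f prob_space.emeasure_space_1[OF prob_space_chain] in \<open>auto simp: N.finite_measure_axioms\<close>)
  then show ?thesis by (simp add: integral_chain f)
qed

lemma bind_chain_prob_space:
  assumes N: "prob_space N" "sets N = sets streamS"
  shows "prob_space (N \<bind> chain g)" "sets (N \<bind> chain g) = sets (coord_alg UNIV)"
proof -
  have K: "chain g \<in> measurable N (prob_algebra (coord_alg UNIV))"
    using measurable_chain measurable_cong_sets[OF N(2) refl] by blast
  show "prob_space (N \<bind> chain g)"
    by (rule prob_space_bind'[OF _ K]) (simp add: space_prob_algebra N)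
  show "sets (N \<bind> chain g) = sets (coord_alg UNIV)"
    by (rule sets_bind'[OF _ K]) (simp add: space_prob_algebra N)
qed

text \<open>On events of the past at time \<open>n - 1\<close>, both \<open>P\<close> and the
  mixture of chains give the integral of the \<open>n\<close>-fold transfer over the law of the
  initial past. Such events determine the measure.\<close>

lemma disintegration:
  assumes P: "prob_space P" "sets P = sets (coord_alg UNIV)"
    and fol: "\<forall>j\<ge>0. follows_kernel_at j g P" and D: "D \<in> sets (coord_alg UNIV)"
  shows "emeasure P D = (\<integral>\<^sup>+z. emeasure (chain g (past (- 1) z)) D \<partial>P)"
proof -
  interpret P: prob_space P by fact
  note [measurable] = measurable_past_sets[OF P(2)]
  let ?N = "distr P streamS (past (- 1))"
  have N: "prob_space ?N" "sets ?N = sets streamS"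
    by (auto intro!: P.prob_space_distr)
  note B = bind_chain_prob_space[OF N]
  have "P = ?N \<bind> chain g"
  proof (rule prob_eqI_past[OF P B(2)])
    fix n :: nat and A :: "'s stream set" assume A: "A \<in> sets streamS"
    interpret B: prob_space "?N \<bind> chain g" by (rule B)
    have ev: "past (int n - 1) -` A \<in> sets (coord_alg UNIV)"
      using measurable_sets[OF measurable_past_UNIV A, of "int n - 1"] by simp
    have bd: "\<bar>indicator A s\<bar> \<le> (1::real)" for s by simp
    have t: "(transfer g ^^ n) (indicator A) \<in> borel_measurable streamS"
      using A by (intro borel_measurable_iterated_transfer[OF g, where C=1]) auto
    have ind: "(indicator A (past (int n - 1) z) :: real) = indicator (past (int n - 1) -` A) z" for z
      by (simp add: indicator_def)
    have "measure P (past (int n - 1) -` A) = (\<integral>z. indicator A (past (int n - 1) z) \<partial>P)"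
      using ev P(2) by (simp add: ind)
    also have "\<dots> = (\<integral>z. (transfer g ^^ n) (indicator A) (past (- 1) z) \<partial>P)"
      using A by (intro follows_kernel_integral_iterated[OF g P fol _ bd]) auto
    also have "\<dots> = (\<integral>s. (transfer g ^^ n) (indicator A) s \<partial>?N)"
      using t by (subst integral_distr) auto
    also have "\<dots> = (\<integral>z. indicator A (past (int n - 1) z) \<partial>(?N \<bind> chain g))"
      using A by (intro integral_bind_chain[OF N _ bd, symmetric]) auto
    also have "\<dots> = measure (?N \<bind> chain g) (past (int n - 1) -` A)"
      using ev B(2) by (simp add: ind)
    finally show "emeasure P (past (int n - 1) -` A) = emeasure (?N \<bind> chain g) (past (int n - 1) -` A)"
      by (simp add: P.emeasure_eq_measure B.emeasure_eq_measure)
  qed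
  then have "emeasure P D = emeasure (?N \<bind> chain g) D" by simp
  also have "\<dots> = (\<integral>\<^sup>+s. emeasure (chain g s) D \<partial>?N)"
  proof (rule emeasure_bind_prob_algebra[OF _ _ D])
    show "chain g \<in> measurable ?N (prob_algebra (coord_alg UNIV))"
      using measurable_chain measurable_cong_sets[OF N(2) refl] by blast
  qed (simp add: space_prob_algebra N)
  also have "\<dots> = (\<integral>\<^sup>+z. emeasure (chain g (past (- 1) z)) D \<partial>P)"
    using measurable_emeasure_kernel[OF measurable_prob_algebraD[OF measurable_chain] D]
    by (subst nn_integral_distr) auto
  finally show ?thesis .
qed

end

section \<open>Total variation on decreasing \<sigma>-algebras\<close>

text \<open>
  If \<open>\<sigma> (B i)\<close> is within \<open>(1/2)^i\<close> of the supremum of the signed measure \<open>\<sigma> = M - N\<close> on \<open>G i\<close>, then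
  modularity of \<open>\<sigma>\<close> shows that the union of the \<open>B i\<close> with \<open>k \<le> i\<close> is still within \<open>2 * (1/2)^k\<close> of the limit
  of the suprema. Hence this limit is at most \<open>\<sigma> (limsup B)\<close>, and \<open>limsup B\<close> is a tail event.
\<close>

lemma tendsto_SUP_decreasing_algebras:
  fixes G :: "nat \<Rightarrow> 'a measure"
  assumes M: "prob_space M" and N: "prob_space N" and sets: "sets N = sets M"
    and G: "\<And>n. sets (G n) \<subseteq> sets M" "\<And>n. space (G n) = space M"
    and mono: "\<And>m n. m \<le> n \<Longrightarrow> sets (G n) \<subseteq> sets (G m)"
    and eq: "\<And>A. (\<And>n. A \<in> sets (G n)) \<Longrightarrow> measure M A = measure N A"
  shows "(\<lambda>n. SUP A\<in>sets (G n). \<bar>measure M A - measure N A\<bar>) \<longlonglongrightarrow> 0"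
proof -
  interpret M: prob_space M by fact
  interpret N: prob_space N by fact
  define \<sigma> where "\<sigma> A = measure M A - measure N A" for A
  define \<delta> where "\<delta> n = (SUP A\<in>sets (G n). \<sigma> A)" for n
  have \<sigma>_bd: "\<bar>\<sigma> A\<bar> \<le> 1" for A
    unfolding \<sigma>_def using M.prob_le_1[of A] N.prob_le_1[of A] measure_nonneg[of M A] measure_nonneg[of N A]
    by linarith
  have bdd: "bdd_above (\<sigma> ` X)" for X
    using \<sigma>_bd by (intro bdd_aboveI2[where M=1]) (auto dest: abs_le_D1)
  have \<sigma>_le: "\<sigma> A \<le> \<delta> n" if "A \<in> sets (G n)" for A n
    unfolding \<delta>_def by (rule cSUP_upper[OF that bdd])
  have \<delta>_nonneg: "0 \<le> \<delta> n" for n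
    using \<sigma>_le[of "{}" n] by (simp add: \<sigma>_def)
  have \<delta>_dec: "decseq \<delta>"
    unfolding decseq_def \<delta>_def by (intro allI impI cSUP_subset_mono bdd mono) auto
  obtain \<delta>' where \<delta>': "\<delta> \<longlonglongrightarrow> \<delta>'" and \<delta>'_le: "\<And>n. \<delta>' \<le> \<delta> n"
    using decseq_convergent[OF \<delta>_dec, of 0] \<delta>_nonneg by auto
  have "\<exists>B\<in>sets (G n). \<delta> n - (1/2)^n < \<sigma> B" for n
    using less_cSUP_iff[OF _ bdd, of "sets (G n)" "\<delta> n - (1/2)^n"] by (auto simp: \<delta>_def)
  then obtain B where B: "\<And>n. B n \<in> sets (G n)" and \<sigma>B: "\<And>n. \<delta> n - (1/2)^n < \<sigma> (B n)"
    by metis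
  have BG: "B i \<in> sets (G k)" if "k \<le> i" for i k
    using B[of i] mono[OF that] by auto
  have modular: "\<sigma> (A \<union> C) + \<sigma> (A \<inter> C) = \<sigma> A + \<sigma> C" if "A \<in> sets M" "C \<in> sets M" for A C
    using that sets measure_Un3[of A M C] measure_Un3[of A N C]
    by (simp add: \<sigma>_def M.fmeasurable_eq_sets N.fmeasurable_eq_sets)
  \<comment> \<open>The errors add up to the geometric sum
    \<open>2 * (1/2)^k - (1/2)^(k + m)\<close>. The union grows at its lower end: its intersection
    with \<open>B k\<close> stays in \<open>G k\<close>, where \<sigma> is at most
    \<open>\<delta> k\<close>, and this cancels the \<open>\<delta> k\<close> gained from
    \<open>B k\<close>.\<close>
  have finite_union: "\<delta> (k + m) - 2 * (1/2)^k \<le> \<sigma> (\<Union>i\<in>{k..k + m}. B i) - (1/2)^(k + m)" for k m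
  proof (induction m arbitrary: k)
    case 0
    then show ?case using \<sigma>B[of k] by simp
  next
    case (Suc m)
    let ?U = "\<Union>i\<in>{Suc k..Suc k + m}. B i"
    have U: "?U \<in> sets (G k)"
      by (intro sets.finite_UN) (auto intro: BG)
    have "{k..k + Suc m} = insert k {Suc k..Suc k + m}" by auto
    then have "(\<Union>i\<in>{k..k + Suc m}. B i) = B k \<union> ?U" by auto
    moreover have "\<sigma> (B k \<union> ?U) + \<sigma> (B k \<inter> ?U) = \<sigma> (B k) + \<sigma> ?U"
      using U G(1)[of k] B[of k] by (intro modular) auto
    moreover have "\<sigma> (B k \<inter> ?U) \<le> \<delta> k"
      using U B[of k] by (intro \<sigma>_le) auto
    ultimately show ?case
      using Suc.IH[of "Suc k"] \<sigma>B[of k] by (simp only: add_Suc add_Suc_right power_Suc)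
  qed
  define V where "V k = (\<Union>i. B (k + i))" for k
  have VG: "V k \<in> sets (G n)" if "n \<le> k" for k n
    unfolding V_def using that by (intro sets.countable_UN') (auto intro: BG)
  have V_lower: "\<delta>' - 2 * (1/2)^k \<le> \<sigma> (V k)" for k
  proof (rule LIMSEQ_le_const)
    have BM: "B i \<in> sets M" for i using B G(1) by blast
    have VU: "V k = (\<Union>m. \<Union>i\<in>{k..k + m}. B i)"
      unfolding V_def by (auto simp: le_iff_add) (meson atLeastAtMost_iff le_add1 order_refl)
    have "incseq (\<lambda>m. \<Union>i\<in>{k..k + m}. B i)"
      unfolding incseq_def by (intro allI impI UN_mono) auto
    then show "(\<lambda>m. \<sigma> (\<Union>i\<in>{k..k + m}. B i)) \<longlonglongrightarrow> \<sigma> (V k)"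
      unfolding \<sigma>_def VU using BM sets
      by (intro tendsto_diff M.finite_Lim_measure_incseq N.finite_Lim_measure_incseq) auto
    have "\<delta>' - 2 * (1/2)^k \<le> \<sigma> (\<Union>i\<in>{k..k + m}. B i)" for m
      using finite_union[of k m] \<delta>'_le[of "k + m"] zero_le_power[of "1/2::real" "k + m"] by linarith
    then show "\<exists>N. \<forall>m\<ge>N. \<delta>' - 2 * (1/2)^k \<le> \<sigma> (\<Union>i\<in>{k..k + m}. B i)" by blast
  qed
  have V_dec: "V (Suc k) \<subseteq> V k" for k
    unfolding V_def by (auto) (metis add_Suc_right)
  then have "decseq V" by (rule decseq_SucI)
  have "\<sigma> (\<Inter>k. V k) = 0"
  proof -
    have "(\<Inter>k. V k) \<in> sets (G n)" for n
    proof -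
      have "V (k + n) \<subseteq> V k" for k
        using decseqD[OF \<open>decseq V\<close>] by simp
      \<comment> \<open>Dropping the first \<open>n\<close> sets of a decreasing sequence keeps the
        intersection, and all remaining sets lie in \<open>G n\<close>.\<close>
      then have "(\<Inter>k. V k) = (\<Inter>k. V (k + n))" by blast
      also have "\<dots> \<in> sets (G n)"
        using VG by (intro sets.countable_INT) auto
      finally show ?thesis .
    qed
    then show ?thesis
      using eq by (simp add: \<sigma>_def)
  qed
  moreover have "\<delta>' \<le> \<sigma> (\<Inter>k. V k)"
  proof (rule LIMSEQ_le)
    show "(\<lambda>k. \<sigma> (V k)) \<longlonglongrightarrow> \<sigma> (\<Inter>k. V k)"
      unfolding \<sigma>_def using \<open>decseq V\<close> VG[OF le0] G(1)[of 0] sets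
      by (intro tendsto_diff M.finite_Lim_measure_decseq N.finite_Lim_measure_decseq) auto
    show "(\<lambda>k. \<delta>' - 2 * (1/2)^k) \<longlonglongrightarrow> \<delta>'"
      by real_asymp
  qed (use V_lower in blast)
  ultimately have \<delta>0: "\<delta> \<longlonglongrightarrow> 0"
    using \<delta>' LIMSEQ_le_const[OF \<delta>', of 0] \<delta>_nonneg by (auto dest: order_antisym)
  \<comment> \<open>Both measures have mass one, so \<sigma> changes sign under complements and the
    one-sided bound becomes two-sided.\<close>
  have abs_le: "\<bar>\<sigma> A\<bar> \<le> \<delta> n" if A: "A \<in> sets (G n)" for A n
  proof -
    have "A \<in> sets M" using A G(1) by blast
    then have "\<sigma> (space M - A) = - \<sigma> A"
      using M.prob_compl[of A] N.prob_compl[of A] sets sets_eq_imp_space_eq[OF sets] by (simp add: \<sigma>_def)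
    then show ?thesis
      using \<sigma>_le[OF A] \<sigma>_le[of "space M - A" n] A sets.compl_sets[of A "G n"] G(2)[of n] by auto
  qed
  show ?thesis
  proof (rule tendsto_sandwich[OF _ _ tendsto_const \<delta>0])
    show "\<forall>\<^sub>F n in sequentially. (SUP A\<in>sets (G n). \<bar>measure M A - measure N A\<bar>) \<le> \<delta> n"
      using abs_le by (intro always_eventually allI cSUP_least) (auto simp: \<sigma>_def)
    show "\<forall>\<^sub>F n in sequentially. 0 \<le> (SUP A\<in>sets (G n). \<bar>measure M A - measure N A\<bar>)"
    proof (intro always_eventually allI)
      fix n
      have "\<bar>measure M {} - measure N {}\<bar> \<le> (SUP A\<in>sets (G n). \<bar>measure M A - measure N A\<bar>)"
        using \<sigma>_bd by (intro cSUP_upper bdd_aboveI2[where M=1]) (auto simp: \<sigma>_def)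
      then show "0 \<le> (SUP A\<in>sets (G n). \<bar>measure M A - measure N A\<bar>)" by simp
    qed
  qed
qed

section \<open>Tail events under dynamic uniqueness\<close>

lemma tail_events_iff: "A \<in> tail_events \<longleftrightarrow> (\<forall>n::nat. A \<in> sets (coord_alg {int n..}))"
proof
  assume A: "A \<in> tail_events"
  show "\<forall>n::nat. A \<in> sets (coord_alg {int n..})"
  proof
    fix n :: nat
    have "A \<in> sets (coord_alg {int (Suc n)..})"
      using A unfolding tail_events_def by (auto dest: bspec[of _ _ "int (Suc n)"])
    then show "A \<in> sets (coord_alg {int n..})"
      by (rule coord_alg_mono[THEN subsetD, rotated]) auto
  qed
next
  assume A: "\<forall>n::nat. A \<in> sets (coord_alg {int n..})"
  have "A \<in> sets (coord_alg {n..})" if "1 \<le> n" for n :: int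
    using A[rule_format, of "nat n"] that by simp
  then show "A \<in> tail_events" unfolding tail_events_def by auto
qed

lemma tail_events_sets: "A \<in> tail_events \<Longrightarrow> A \<in> sets (coord_alg UNIV)"
  unfolding tail_events_iff using coord_alg_mono[OF subset_UNIV, of "{int 0..}"] by blast

text \<open>By \<open>disintegration\<close> the left side is an average of the probabilities of
  \<open>A\<close> under the chains, and dynamic uniqueness makes these constant.\<close>

lemma measure_tail_event:
  fixes g :: "'s::finite stream \<Rightarrow> real"
  assumes g: "kernel g" "dynamic_uniqueness g"
    and P: "prob_space P" "sets P = sets (coord_alg UNIV)" "\<forall>j\<ge>0. follows_kernel_at j g P"
    and A: "A \<in> tail_events"
  shows "measure P A = measure (chain g x) A"
proof -
  interpret P: prob_space P by fact
  have "measure (chain g y) A = measure (chain g x) A" for y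
    using g(2) started_from_chain[OF g(1)] A unfolding dynamic_uniqueness_def by blast
  then have "emeasure (chain g y) A = measure (chain g x) A" for y
    using finite_measure.emeasure_eq_measure[OF prob_space.finite_measure[OF prob_space_chain[OF g(1)]]] by simp
  then have "emeasure P A = measure (chain g x) A"
    using disintegration[OF g(1) P tail_events_sets[OF A]] by (simp add: P.emeasure_space_1)
  then show ?thesis by (simp add: measure_def)
qed

text \<open>The futures decrease to the tail events, on which both measures agree with one and the
  same chain.\<close>

lemma tendsto_SUP_future:
  fixes g :: "'s::finite stream \<Rightarrow> real"
  assumes g: "kernel g" "dynamic_uniqueness g"
    and P: "prob_space P" "sets P = sets (coord_alg UNIV)" "\<forall>j\<ge>0. follows_kernel_at j g P"
    and Q: "prob_space Q" "sets Q = sets (coord_alg UNIV)" "\<forall>j\<ge>0. follows_kernel_at j g Q"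
  shows "(\<lambda>n. SUP A\<in>sets (coord_alg {int n..}). \<bar>measure P A - measure Q A\<bar>) \<longlonglongrightarrow> 0"
proof (rule tendsto_SUP_decreasing_algebras[OF P(1) Q(1)])
  show "sets (coord_alg {int n..}) \<subseteq> sets P" for n
    unfolding P(2) by (rule coord_alg_mono) simp
  show "sets (coord_alg {int n..}) \<subseteq> sets (coord_alg {int m..})" if "m \<le> n" for m n
    using that by (intro coord_alg_mono) auto
  show "measure P A = measure Q A" if "\<And>n. A \<in> sets (coord_alg {int n..})" for A
    using that measure_tail_event[OF g P] measure_tail_event[OF g Q] tail_events_iff[of A] by metis
qed (use P Q sets_eq_imp_space_eq[OF P(2)] in auto)

section \<open>Shifts and uniqueness\<close>

definition shift_by :: "nat \<Rightarrow> (int \<Rightarrow> 's) \<Rightarrow> int \<Rightarrow> 's" where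
  "shift_by m z = (\<lambda>i. z (i + int m))"

lemma past_shift_by: "past j (shift_by m z) = past (j + int m) z"
  by (simp add: past_def shift_by_def algebra_simps)

lemma measurable_shift_by:
  "(\<lambda>i. i + int m) ` I \<subseteq> J \<Longrightarrow>
    shift_by m \<in> measurable (coord_alg J) (coord_alg I :: (int \<Rightarrow> 's::finite) measure)"
  unfolding shift_by_def by (intro measurable_to_coord_alg measurable_coord) auto

lemma measurable_shift_by_sets:
  "sets P = sets (coord_alg UNIV :: (int \<Rightarrow> 's::finite) measure) \<Longrightarrow> shift_by m \<in> measurable P (coord_alg UNIV)"
  using measurable_shift_by[of m UNIV UNIV] measurable_cong_sets by blast

lemma stationary_shift_by:
  fixes P :: "(int \<Rightarrow> 's::finite) measure"
  assumes P: "sets P = sets (coord_alg UNIV)" "stationary P"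
  shows "distr P (coord_alg UNIV) (shift_by m) = P"
proof (induction m)
  case 0
  have "distr P (coord_alg UNIV) (\<lambda>z. z) = distr P P (\<lambda>z. z)"
    by (rule distr_cong) (simp_all add: P(1))
  then show ?case by (simp add: shift_by_def[abs_def] distr_id)
next
  case (Suc m)
  have 1: "distr P (coord_alg UNIV) (shift_by 1) = P"
    using P(2) distr_cong[OF refl P(1)[symmetric], of P "shift_by 1" "shift_by 1"]
    unfolding stationary_def by (simp add: shift_by_def[abs_def])
  have "distr P (coord_alg UNIV) (shift_by (Suc m))
      = distr (distr P (coord_alg UNIV) (shift_by 1)) (coord_alg UNIV) (shift_by m)"
    by (subst distr_distr[OF measurable_shift_by_sets measurable_shift_by_sets])
      (simp_all add: P(1) comp_def shift_by_def[abs_def] algebra_simps)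
  then show ?case using 1 Suc by simp
qed

lemma follows_kernel_at_shift:
  fixes g :: "'s::finite stream \<Rightarrow> real"
  assumes g: "kernel g" and P: "prob_space P" "sets P = sets (coord_alg UNIV)"
    and fol: "follows_kernel_at (j + int m) g P"
  shows "follows_kernel_at j g (distr P (coord_alg UNIV) (shift_by m))" (is "follows_kernel_at j g ?Q")
proof (rule follows_kernel_atI[OF g])
  note s[measurable] = measurable_shift_by_sets[OF P(2)]
  show "prob_space ?Q" by (rule prob_space.prob_space_distr[OF P(1) s])
  fix B :: "'s stream set" assume [measurable]: "B \<in> sets streamS"
  have t[measurable]: "transfer g (indicator B) \<in> borel_measurable streamS"
    by (rule borel_measurable_transfer[OF g]) simp
  have "(\<integral>z. indicator B (past j z) \<partial>?Q) = (\<integral>z. indicator B (past (j + int m) z) \<partial>P :: real)"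
    by (subst integral_distr) (auto simp: past_shift_by)
  also have "\<dots> = (\<integral>z. transfer g (indicator B) (past (j + int m - 1) z) \<partial>P)"
    by (rule follows_kernel_at_integral[OF g P fol, where C=1]) auto
  also have "\<dots> = (\<integral>z. transfer g (indicator B) (past (j - 1) z) \<partial>?Q)"
    by (subst integral_distr) (auto simp: past_shift_by algebra_simps)
  finally show "(\<integral>z. indicator B (past j z) \<partial>?Q) = (\<integral>z. transfer g (indicator B) (past (j - 1) z) \<partial>?Q)" .
qed simp

text \<open>The definition prescribes the conditional law at time 0 only. Stationarity carries its
  integral form to time \<open>j\<close>, because \<open>past j\<close> is \<open>past 0\<close> of
  the shifted sequence.\<close>

lemma g_measure_follows_kernel:
  fixes g :: "'s::finite stream \<Rightarrow> real"
  assumes g: "kernel g" and P: "g_measure g P"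
  shows "\<forall>j\<ge>0. follows_kernel_at j g P"
proof (intro allI impI)
  fix j :: int assume "0 \<le> j"
  have P': "prob_space P" "sets P = sets (coord_alg UNIV)" "stationary P" "follows_kernel_at 0 g P"
    using P by (auto simp: g_measure_def)
  show "follows_kernel_at j g P"
  proof (rule follows_kernel_atI[OF g P'(1,2)])
    fix B :: "'s stream set" assume B[measurable]: "B \<in> sets streamS"
    note [measurable] = measurable_shift_by_sets[OF P'(2)]
    have shift: "(\<integral>z. f (past (i + j) z) \<partial>P) = (\<integral>z. f (past i z) \<partial>P)"
      if [measurable]: "f \<in> borel_measurable streamS" for f :: "'s stream \<Rightarrow> real" and i
    proof -
      have "past (i + j) z = past i (shift_by (nat j) z)" for z :: "int \<Rightarrow> 's"
        using \<open>0 \<le> j\<close> by (simp add: past_shift_by)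
      then have "(\<integral>z. f (past (i + j) z) \<partial>P) = (\<integral>z. f (past i z) \<partial>distr P (coord_alg UNIV) (shift_by (nat j)))"
        by (subst integral_distr) auto
      then show ?thesis by (simp only: stationary_shift_by[OF P'(2,3)])
    qed
    have "(\<integral>z. indicator B (past j z) \<partial>P) = (\<integral>z. transfer g (indicator B) (past (0 - 1) z) \<partial>P)"
      using shift[of "indicator B" 0] follows_kernel_at_integral[OF g P'(1,2,4), of "indicator B" 1] by simp
    also have "\<dots> = (\<integral>z. transfer g (indicator B) (past (j - 1) z) \<partial>P)"
      using shift[of "transfer g (indicator B)" "- 1"] borel_measurable_transfer[OF g, of "indicator B"] by simp
    finally show "(\<integral>z. indicator B (past j z) \<partial>P) = (\<integral>z. transfer g (indicator B) (past (j - 1) z) \<partial>P)" .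
  qed
qed

lemma abs_measure_diff_le_SUP:
  assumes "prob_space P" "prob_space Q" "A \<in> X"
  shows "\<bar>measure P A - measure Q A\<bar> \<le> (SUP A\<in>X. \<bar>measure P A - measure Q A\<bar>)"
proof (rule cSUP_upper[OF assms(3) bdd_aboveI2[where M=1]])
  fix A
  show "\<bar>measure P A - measure Q A\<bar> \<le> 1"
    using prob_space.prob_le_1[OF assms(1), of A] prob_space.prob_le_1[OF assms(2), of A]
      measure_nonneg[of P A] measure_nonneg[of Q A] by linarith
qed

text \<open>The shift by \<open>m + n\<close> moves an event on \<open>{- int n..}\<close> into
  \<open>{int m..}\<close> and preserves its probability under both measures. Their difference is
  thus bounded by a quantity that vanishes as \<open>m\<close> grows.\<close>

lemma g_measure_unique:
  fixes g :: "'s::finite stream \<Rightarrow> real"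
  assumes g: "kernel g" "dynamic_uniqueness g" and P: "g_measure g P" and Q: "g_measure g Q"
  shows "P = Q"
proof (rule prob_eqI_filtration[where I="\<lambda>n. {- int n..}"])
  have P': "prob_space P" "sets P = sets (coord_alg UNIV)" and Ps: "stationary P"
    and Q': "prob_space Q" "sets Q = sets (coord_alg UNIV)" and Qs: "stationary Q"
    using P Q by (auto simp: g_measure_def)
  show "prob_space P" "sets P = sets (coord_alg UNIV)" "sets Q = sets (coord_alg UNIV)" by fact+
  show "incseq (\<lambda>n. {- int n..})" by (auto simp: incseq_def)
  show "(\<Union>n. {- int n..}) = UNIV"
  proof (intro equalityI subsetI UN_I)
    fix i :: int show "i \<in> {- int (nat (- i))..}" by auto
  qed auto
  fix n :: nat and A :: "(int \<Rightarrow> 's) set" assume A: "A \<in> sets (coord_alg {- int n..})"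
  let ?d = "\<lambda>m. SUP A\<in>sets (coord_alg {int m..}). \<bar>measure P A - measure Q A\<bar>"
  have "\<bar>measure P A - measure Q A\<bar> \<le> ?d m" for m
  proof -
    have AU: "A \<in> sets (coord_alg UNIV)"
      using A coord_alg_mono[OF subset_UNIV] by blast
    have eq: "measure R A = measure R (shift_by (m + n) -` A)"
      if R: "sets R = sets (coord_alg UNIV)" "stationary R" for R
    proof -
      have "measure R A = measure (distr R (coord_alg UNIV) (shift_by (m + n))) A"
        by (simp only: stationary_shift_by[OF R])
      also have "\<dots> = measure R (shift_by (m + n) -` A)"
        using AU R sets_eq_imp_space_eq[OF R(1)] by (subst measure_distr[OF measurable_shift_by_sets]) auto
      finally show ?thesis .
    qed
    have "(\<lambda>i. i + int (m + n)) ` {- int n..} \<subseteq> {int m..}" by auto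
    then have "shift_by (m + n) -` A \<in> sets (coord_alg {int m..})"
      using measurable_sets[OF measurable_shift_by A] by auto
    then show ?thesis
      unfolding eq[OF P'(2) Ps] eq[OF Q'(2) Qs] by (rule abs_measure_diff_le_SUP[OF P'(1) Q'(1)])
  qed
  then have "\<bar>measure P A - measure Q A\<bar> \<le> 0"
    by (intro LIMSEQ_le_const[OF tendsto_SUP_future[OF g P' g_measure_follows_kernel[OF g(1) P]
          Q' g_measure_follows_kernel[OF g(1) Q]]]) auto
  then show "emeasure P A = emeasure Q A"
    using P'(1) Q'(1) by (simp add: finite_measure.emeasure_eq_measure prob_space.finite_measure)
qed

section \<open>Absolute regularity\<close>

text \<open>Once the past is frozen at \<open>x\<close>, an event of \<open>joint_alg n\<close>
  constrains only the coordinates from \<open>n\<close> on; here this holds for every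
  \<open>n\<close>.\<close>

lemma section_tail_event:
  assumes "\<And>n. D \<in> sets (joint_alg n)"
  shows "{y. glue (x, y) \<in> D} \<in> tail_events"
  unfolding tail_events_iff
proof
  fix n :: nat
  have "(\<lambda>y. glue (x, y)) \<in> measurable (coord_alg {int n..}) (joint_alg n)"
    by (rule measurable_compose[OF measurable_Pair1' measurable_glue]) simp
  from measurable_sets[OF this assms] show "{y. glue (x, y) \<in> D} \<in> sets (coord_alg {int n..})"
    by (simp add: vimage_def)
qed

lemma joint_alg_mono: "m \<le> n \<Longrightarrow> sets (joint_alg n) \<subseteq> sets (joint_alg m)"
  unfolding sets_joint_alg using coord_alg_mono[of "{int n..}" "{int m..}"]
  by (intro sigma_sets_mono') auto

lemma glue_measurable_UNIV:
  "glue \<in> measurable (coord_alg UNIV \<Otimes>\<^sub>M coord_alg UNIV) (coord_alg UNIV :: (int \<Rightarrow> 's::finite) measure)"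
proof (rule measurable_to_coord_alg)
  fix i :: int
  have "(\<lambda>z :: (int \<Rightarrow> 's) \<times> (int \<Rightarrow> 's). fst z i) \<in> measurable (coord_alg UNIV \<Otimes>\<^sub>M coord_alg UNIV) (count_space UNIV)"
    "(\<lambda>z :: (int \<Rightarrow> 's) \<times> (int \<Rightarrow> 's). snd z i) \<in> measurable (coord_alg UNIV \<Otimes>\<^sub>M coord_alg UNIV) (count_space UNIV)"
    by (intro measurable_compose[OF measurable_fst measurable_coord] measurable_compose[OF measurable_snd measurable_coord]; simp)+
  then show "(\<lambda>z :: (int \<Rightarrow> 's) \<times> (int \<Rightarrow> 's). glue z i) \<in> measurable (coord_alg UNIV \<Otimes>\<^sub>M coord_alg UNIV) (count_space UNIV)"
    by (cases "i < 0") (simp_all add: glue_def split_def)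
qed

text \<open>The law on the left makes past and future independent and lives on the full algebra. It
  is a single measure that agrees with \<open>joint_product n P\<close> on every
  \<open>joint_alg n\<close>, as comparing whole sequences of algebras requires.\<close>

lemma emeasure_glue_product:
  fixes P :: "(int \<Rightarrow> 's::finite) measure"
  assumes P: "prob_space P" "sets P = sets (coord_alg UNIV)" and D: "D \<in> sets (coord_alg UNIV)"
  shows "emeasure (distr (P \<Otimes>\<^sub>M P) (coord_alg UNIV) glue) D = (\<integral>\<^sup>+x. emeasure P {y. glue (x, y) \<in> D} \<partial>P)"
proof -
  interpret P: prob_space P by fact
  have sp: "space P = UNIV" using sets_eq_imp_space_eq[OF P(2)] by simp
  have gl: "glue \<in> measurable (P \<Otimes>\<^sub>M P) (coord_alg UNIV)"
    using glue_measurable_UNIV measurable_cong_sets[OF sets_pair_measure_cong[OF P(2) P(2)] refl] by blast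
  have "emeasure (distr (P \<Otimes>\<^sub>M P) (coord_alg UNIV) glue) D = emeasure (P \<Otimes>\<^sub>M P) (glue -` D)"
    using emeasure_distr[OF gl D] by (simp add: space_pair_measure sp)
  also have "\<dots> = (\<integral>\<^sup>+x. emeasure P {y. glue (x, y) \<in> D} \<partial>P)"
    using measurable_sets[OF gl D]
    by (subst P.emeasure_pair_measure_alt) (simp_all add: space_pair_measure sp vimage_def)
  finally show ?thesis .
qed

text \<open>Fubini gives the same integral as in \<open>emeasure_glue_product\<close>; the
  restrictions to subalgebras are removed first from the outer and then from the inner
  integral.\<close>

lemma emeasure_joint_product_eq:
  fixes P :: "(int \<Rightarrow> 's::finite) measure"
  assumes P: "prob_space P" "sets P = sets (coord_alg UNIV)" and D: "D \<in> sets (joint_alg n)"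
  shows "emeasure (joint_product n P) D = (\<integral>\<^sup>+x. emeasure P {y. glue (x, y) \<in> D} \<partial>P)"
proof -
  let ?M1 = "restr_to_subalg P (coord_alg {..- 1})"
  let ?M2 = "restr_to_subalg P (coord_alg {int n..})"
  note sub = subalgebra_coord_alg[OF P(2)]
  have s: "sets ?M1 = sets (coord_alg {..- 1})" "sets ?M2 = sets (coord_alg {int n..})"
    using sets_restr_to_subalg[OF sub] by auto
  interpret M2: prob_space ?M2 by (rule prob_space_restr_to_subalg[OF sub P(1)])
  have sp: "space P = UNIV" using sets_eq_imp_space_eq[OF P(2)] by simp
  have gl: "glue \<in> measurable (?M1 \<Otimes>\<^sub>M ?M2) (joint_alg n)"
    using measurable_glue[of n] measurable_cong_sets[OF sets_pair_measure_cong[OF s] refl] by blast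
  have ev: "glue -` D \<in> sets (?M1 \<Otimes>\<^sub>M ?M2)"
    using measurable_sets[OF gl D] by (simp add: space_pair_measure space_restr_to_subalg sp)
  have "emeasure (joint_product n P) D = emeasure (?M1 \<Otimes>\<^sub>M ?M2) (glue -` D)"
    unfolding joint_product_def
    using emeasure_distr[OF gl D] by (simp add: space_pair_measure space_restr_to_subalg sp)
  also have "\<dots> = (\<integral>\<^sup>+x. emeasure ?M2 (Pair x -` glue -` D) \<partial>?M1)"
    by (rule M2.emeasure_pair_measure_alt[OF ev])
  also have "\<dots> = (\<integral>\<^sup>+x. emeasure ?M2 (Pair x -` glue -` D) \<partial>P)"
    using M2.measurable_emeasure_Pair[OF ev] measurable_cong_sets[OF s(1) refl]
    by (intro nn_integral_subalgebra2[OF sub]) blast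
  also have "\<dots> = (\<integral>\<^sup>+x. emeasure P {y. glue (x, y) \<in> D} \<partial>P)"
    using sets_Pair1[OF ev] s(2)
    by (intro nn_integral_cong) (simp add: emeasure_restr_to_subalg[OF sub] vimage_def)
  finally show ?thesis .
qed

text \<open>Under the chain started from the past of \<open>z\<close>, the event \<open>D\<close>
  coincides almost surely with its section at \<open>z\<close>. The section is a tail event, so
  \<open>P\<close> gives it the same probability. Integration over \<open>z\<close> is
  \<open>disintegration\<close> on one side and Fubini on the other.\<close>

lemma emeasure_joint_tail_event:
  fixes g :: "'s::finite stream \<Rightarrow> real"
  assumes g: "kernel g" "dynamic_uniqueness g"
    and P: "prob_space P" "sets P = sets (coord_alg UNIV)" "\<forall>j\<ge>0. follows_kernel_at j g P"
    and D: "\<And>n. D \<in> sets (joint_alg n)"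
  shows "emeasure P D = emeasure (distr (P \<Otimes>\<^sub>M P) (coord_alg UNIV) glue) D"
proof -
  have DU: "D \<in> sets (coord_alg UNIV)"
    using D[of 0] subalgebra_joint_alg[OF refl, of 0] by (auto simp: subalgebra_def)
  have "emeasure (chain g (past (- 1) z)) D = emeasure P {y. glue (z, y) \<in> D}" for z
  proof -
    let ?K = "chain g (past (- 1) z)" and ?S = "{y. glue (z, y) \<in> D}"
    interpret K: prob_space ?K by (rule prob_space_chain[OF g(1)])
    interpret P: prob_space P by fact
    have S: "?S \<in> tail_events" by (rule section_tail_event[OF D])
    have "AE y in ?K. y \<in> D \<longleftrightarrow> y \<in> ?S"
      using chain_past_AE[OF g(1), of "past (- 1) z"]
    proof eventually_elim
      case (elim y)
      have "glue (z, y) i = y i" for i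
      proof (cases "i < 0")
        case True
        then show ?thesis
          using past_nth[of "- 1" y "nat (- 1 - i)"] past_nth[of "- 1" z "nat (- 1 - i)"] elim
          by (simp add: glue_def)
      qed (simp add: glue_def)
      then have "glue (z, y) = y" by blast
      then show ?case by simp
    qed
    then have "emeasure ?K D = emeasure ?K ?S"
      using DU tail_events_sets[OF S] by (intro emeasure_eq_AE) auto
    also have "\<dots> = emeasure P ?S"
      by (simp add: K.emeasure_eq_measure P.emeasure_eq_measure measure_tail_event[OF g P S, of "past (- 1) z"])
    finally show ?thesis .
  qed
  then show ?thesis
    by (simp add: disintegration[OF g(1) P DU] emeasure_glue_product[OF P(1,2) DU])
qed

text \<open>\<open>tendsto_SUP_decreasing_algebras\<close> is applied to the independent gluing and
  \<open>P\<close>; the common events of all joint algebras are settled by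
  \<open>emeasure_joint_tail_event\<close>.\<close>

lemma g_measure_weak_bernoulli:
  fixes g :: "'s::finite stream \<Rightarrow> real"
  assumes g: "kernel g" "dynamic_uniqueness g" and P: "g_measure g P"
  shows "weak_bernoulli P"
proof -
  have P': "prob_space P" "sets P = sets (coord_alg UNIV)"
    using P by (auto simp: g_measure_def)
  interpret P: prob_space P by (rule P')
  interpret PP: pair_prob_space P P ..
  let ?N = "distr (P \<Otimes>\<^sub>M P) (coord_alg UNIV) glue"
  have gl: "glue \<in> measurable (P \<Otimes>\<^sub>M P) (coord_alg UNIV)"
    using glue_measurable_UNIV measurable_cong_sets[OF sets_pair_measure_cong[OF P'(2) P'(2)] refl] by blast
  have sub: "subalgebra P (joint_alg n)" for n by (rule subalgebra_joint_alg[OF P'(2)])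
  have "(\<lambda>n. SUP D\<in>sets (joint_alg n). \<bar>measure ?N D - measure P D\<bar>) \<longlonglongrightarrow> 0"
  proof (rule tendsto_SUP_decreasing_algebras)
    show "measure ?N D = measure P D" if "\<And>n. D \<in> sets (joint_alg n)" for D
      using emeasure_joint_tail_event[OF g P' g_measure_follows_kernel[OF g(1) P] that] by (simp add: measure_def)
    show "prob_space ?N" by (rule PP.prob_space_distr[OF gl])
    show "sets (joint_alg n) \<subseteq> sets (joint_alg m)" if "m \<le> n" for m n
      by (rule joint_alg_mono[OF that])
  qed (use sub[unfolded subalgebra_def] P' in \<open>auto simp: P.prob_space_axioms\<close>)
  moreover have "measure (joint_product n P) D = measure ?N D \<and> measure (restr_to_subalg P (joint_alg n)) D = measure P D"
    if D: "D \<in> sets (joint_alg n)" for n D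
  proof -
    have "D \<in> sets (coord_alg UNIV)" using D sub[of n] P'(2) by (auto simp: subalgebra_def)
    then show ?thesis
      using emeasure_joint_product_eq[OF P' D] emeasure_glue_product[OF P'] emeasure_restr_to_subalg[OF sub D]
      by (simp add: measure_def)
  qed
  moreover have "sets (joint_product n P) = sets (joint_alg n)" for n
    by (simp add: joint_product_def)
  ultimately show ?thesis
    unfolding weak_bernoulli_def d_TV_def
    by (auto intro!: tendsto_mult_right_zero cong: SUP_cong)
qed

section \<open>Existence\<close>

text \<open>Real suprema are upper bounds only of bounded sets; the bound 1, from the range of
  \<open>g\<close>, and the finiteness of the alphabet provide this at each level of the
  nesting.\<close>

lemma kernel_var_upper:
  assumes "kernel g"
  shows "\<bar>g (a ## w @- x) - g (a ## w @- y)\<bar> \<le> kernel_var (length w) g"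
proof -
  have le1: "\<bar>g s - g t\<bar> \<le> 1" for s t
    using kernelD(2,3)[OF assms, of s] kernelD(2,3)[OF assms, of t] by linarith
  define h where "h a w = (SUP (x, y)\<in>UNIV. \<bar>g (a ## w @- x) - g (a ## w @- y)\<bar>)" for a w
  have h_le: "h a w \<le> 1" for a w
    unfolding h_def by (rule cSUP_least) (auto simp: le1)
  have "\<bar>g (a ## w @- x) - g (a ## w @- y)\<bar> \<le> h a w"
    unfolding h_def
    by (rule cSUP_upper2[where x="(x, y)"]) (auto intro!: bdd_aboveI2[where M=1] simp: le1)
  also have "\<dots> \<le> (SUP w\<in>{w'. length w' = length w}. h a w)"
    by (rule cSUP_upper) (auto intro!: bdd_aboveI2[where M=1] h_le)
  also have "\<dots> \<le> kernel_var (length w) g"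
    unfolding kernel_var_def h_def[symmetric]
    by (rule cSUP_upper) auto
  finally show ?thesis .
qed

text \<open>Continuity of \<open>g\<close> in the form suited to limits on cylinders: up to
  \<open>e\<close>, and uniformly, the transfer depends on finitely many letters.\<close>

lemma transfer_sstart_approx:
  fixes g :: "'s::finite stream \<Rightarrow> real"
  assumes g: "kernel g" "continuous_kernel g" and "0 < e"
  shows "\<exists>m. \<forall>s y. \<bar>transfer g (indicator (sstart UNIV w)) s - transfer g (indicator (sstart UNIV w)) (stake m s @- y)\<bar> < e"
proof -
  let ?c = "real (card (UNIV :: 's set))"
  have c: "0 < ?c" by (simp add: card_gt_0_iff)
  have "\<forall>\<^sub>F k in sequentially. kernel_var k g < e / ?c"
    using g(2) c \<open>0 < e\<close> unfolding continuous_kernel_def by (intro order_tendstoD) auto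
  then obtain k where k: "\<And>m. k \<le> m \<Longrightarrow> kernel_var m g < e / ?c"
    by (auto simp: eventually_sequentially)
  \<comment> \<open>\<open>k\<close> makes the variation smaller than \<open>e\<close> divided by
    the number of letters over which the transfer sums; \<open>length w\<close> ensures that
    exchanging the tail leaves the cylinder indicator unchanged.\<close>
  let ?m = "max k (length w)"
  have "\<bar>transfer g (indicator (sstart UNIV w)) s - transfer g (indicator (sstart UNIV w)) (stake ?m s @- y)\<bar> < e" for s y
  proof -
    let ?s = "stake ?m s @- y"
    have mem: "a ## ?s \<in> sstart UNIV w \<longleftrightarrow> a ## s \<in> sstart UNIV w" for a
      by (auto simp: in_sstart_UNIV Stream_snth shift_snth split: nat.splits)
    have "\<bar>g (a ## s) - g (a ## ?s)\<bar> < e / ?c" for a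
      using order.strict_trans1[OF kernel_var_upper[OF g(1), of a "stake ?m s" "sdrop ?m s" y] k]
      by (simp add: stake_sdrop)
    then have "\<bar>g (a ## s) * indicator (sstart UNIV w) (a ## s) - g (a ## ?s) * indicator (sstart UNIV w) (a ## ?s)\<bar> < e / ?c" for a
      using \<open>0 < e\<close> c by (auto simp: mem indicator_def)
    then have "(\<Sum>a\<in>UNIV. \<bar>g (a ## s) * indicator (sstart UNIV w) (a ## s)
        - g (a ## ?s) * indicator (sstart UNIV w) (a ## ?s)\<bar>) < (\<Sum>a\<in>(UNIV::'s set). e / ?c)"
      by (intro sum_strict_mono) auto
    also have "\<dots> = e" using c by simp
    finally show ?thesis
      unfolding transfer_def sum_subtractf[symmetric] by (rule order.strict_trans1[OF sum_abs])
  qed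
  then show ?thesis by blast
qed

section \<open>Cylinder probabilities of laws on streams\<close>

lemma sstart_eq_UN_snoc: "sstart UNIV w = (\<Union>a. sstart UNIV (w @ [a]))"
  by (auto simp: in_sstart_UNIV nth_append less_Suc_eq)

lemma sum_measure_sstart_snoc:
  assumes N: "prob_space N" "sets N = sets streamS"
  shows "(\<Sum>a\<in>UNIV. measure N (sstart UNIV (w @ [a]))) = measure N (sstart UNIV (w :: 's::finite list))"
proof -
  interpret N: prob_space N by fact
  have "s !! length w = a" if "s \<in> sstart UNIV (w @ [a])" for s a
    using that by (auto simp: in_sstart_UNIV dest!: spec[of _ "length w"])
  then have "disjoint_family_on (\<lambda>a. sstart UNIV (w @ [a])) UNIV"
    unfolding disjoint_family_on_def by blast
  then show ?thesis
    unfolding sstart_eq_UN_snoc[of w]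
    by (intro N.finite_measure_finite_Union[symmetric]) (auto simp: N(2) sstart_sets)
qed

lemma stream_measure_eqI:
  assumes N: "prob_space N" "sets N = sets streamS" and M: "prob_space M" "sets M = sets streamS"
    and eq: "\<And>w. measure M (sstart UNIV w) = measure N (sstart UNIV (w :: 's::finite list))"
  shows "M = N"
proof (rule stream_space_eq_sstart[of "UNIV :: 's set"])
  show "emeasure M (sstart UNIV w) = emeasure N (sstart UNIV w)" for w
    using eq N(1) M(1) by (simp add: finite_measure.emeasure_eq_measure prob_space.finite_measure)
qed (use N M in \<open>auto simp: countable_finite\<close>)

text \<open>A Krylov-Bogoliubov argument in which dynamic uniqueness replaces averaging over time:
  consecutive laws of the past merge on cylinders, so a limit along a subsequence is already
  invariant.\<close>

lemma ex_invariant_past: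
  fixes g :: "'s::finite stream \<Rightarrow> real"
  assumes g: "kernel g" "continuous_kernel g" "dynamic_uniqueness g"
  shows "\<exists>M. prob_space M \<and> sets M = sets streamS \<and>
    (\<forall>w. measure M (sstart UNIV w) = (\<integral>s. transfer g (indicator (sstart UNIV w)) s \<partial>M))"
proof -
  define x :: "'s stream" where "x = sconst undefined"
  define N where "N n = distr (chain g x) streamS (past (int n - 1))" for n
  \<comment> \<open>The past of \<open>Q\<close> before time 0 is random, but \<open>Q\<close> still
    follows \<open>g\<close> from time 0 on, so \<open>tendsto_SUP_future\<close> compares it with
    the chain.\<close>
  define Q where "Q = distr (chain g x) (coord_alg UNIV) (shift_by 1)"
  interpret X: prob_space "chain g x" by (rule prob_space_chain[OF g(1)])
  note [measurable] = measurable_past_sets[OF sets_chain] measurable_shift_by_sets[OF sets_chain]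
  have sp: "space (chain g x) = UNIV"
    using sets_eq_imp_space_eq[OF sets_chain] by simp
  have N: "prob_space (N n)" "sets (N n) = sets streamS" for n
    unfolding N_def by (auto intro!: X.prob_space_distr)
  have N_int: "(\<integral>s. f s \<partial>N n) = (transfer g ^^ n) f x" if "f \<in> borel_measurable streamS" for f n
    unfolding N_def using that by (subst integral_distr) (simp_all add: integral_chain[OF g(1)])
  have cyl: "sstart UNIV w \<in> sets streamS" for w :: "'s list" by (rule sstart_sets)
  define a where "a n w = measure (N n) (sstart UNIV w)" for n w
  have a_chain: "a n w = measure (chain g x) (past (int n - 1) -` sstart UNIV w)" for n w
    unfolding a_def N_def by (subst measure_distr) (auto simp: sp cyl)
  have a_Suc: "a (Suc n) w = (\<integral>s. transfer g (indicator (sstart UNIV w)) s \<partial>N n)" for n w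
  proof -
    have "a (Suc n) w = (\<integral>s. indicator (sstart UNIV w) s \<partial>N (Suc n))"
      unfolding a_def by (simp add: cyl N(2) space_stream_space)
    then show ?thesis
      using N_int[of "indicator (sstart UNIV w)" "Suc n"] N_int[of "transfer g (indicator (sstart UNIV w))" n]
        borel_measurable_transfer[OF g(1), of "indicator (sstart UNIV w)"] cyl[of w]
      by (simp add: funpow_swap1)
  qed
  have a_shift: "(\<lambda>n. a (Suc n) w - a n w) \<longlonglongrightarrow> 0" for w
  proof (rule LIMSEQ_offset)
    let ?d = "\<lambda>n. SUP A\<in>sets (coord_alg {int n..}). \<bar>measure Q A - measure (chain g x) A\<bar>"
    have Q: "prob_space Q" "sets Q = sets (coord_alg UNIV)"
      unfolding Q_def by (auto intro!: X.prob_space_distr)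
    have fol: "\<forall>j\<ge>0. follows_kernel_at j g (chain g x)"
      using started_from_chain[OF g(1)] by (auto simp: started_from_def)
    then have folQ: "\<forall>j\<ge>0. follows_kernel_at j g Q"
      unfolding Q_def by (auto intro!: follows_kernel_at_shift[OF g(1) prob_space_chain[OF g(1)]])
    have d: "?d \<longlonglongrightarrow> 0"
      by (rule tendsto_SUP_future[OF g(1,3) Q folQ prob_space_chain[OF g(1)] sets_chain fol])
    \<comment> \<open>The offset \<open>length w\<close> makes the cylinder read only the times from
      \<open>n\<close> to \<open>n + length w - 1\<close>, so it is an event of the future from
      \<open>n\<close> on.\<close>
    have "norm (a (Suc (n + length w)) w - a (n + length w) w) \<le> ?d n" for n
    proof -
      let ?A = "past (int (n + length w) - 1) -` sstart UNIV w"
      have "?A = {z. \<forall>i\<in>{..<length w}. z (int (n + length w) - 1 - int i) = w ! i}"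
        by (auto simp: in_sstart_UNIV)
      also have "\<dots> = (\<Inter>i\<in>{..<length w}. {z. z (int (n + length w) - 1 - int i) = w ! i}) \<inter> UNIV"
        by auto
      also have "\<dots> \<in> sets (coord_alg {int n..})"
        using sets.top[of "coord_alg {int n..}"] unfolding space_coord_alg
        by (cases "w = []") (auto intro!: sets.Int sets.finite_INT, auto simp: sets_coord_alg intro!: sigma_sets.Basic)
      finally have A: "?A \<in> sets (coord_alg {int n..})" .
      have "measure Q ?A = a (Suc (n + length w)) w"
        unfolding Q_def a_chain using measurable_sets[OF measurable_past_UNIV cyl, of "int (n + length w) - 1" w]
        by (subst measure_distr) (auto simp: sp vimage_def past_shift_by algebra_simps)
      then show ?thesis
        using abs_measure_diff_le_SUP[OF Q(1) prob_space_chain[OF g(1)] A] by (simp only: a_chain real_norm_def)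
    qed
    then show "(\<lambda>n. a (Suc (n + length w)) w - a (n + length w) w) \<longlonglongrightarrow> 0"
      by (intro Lim_null_comparison[OF _ d]) auto
  qed
  have a_le: "norm (a n w) \<le> 1" for n w
    unfolding a_def by (simp add: prob_space.prob_le_1[OF N(1)])
  \<comment> \<open>There are countably many words, so a diagonal subsequence makes all cylinder
    probabilities converge at once.\<close>
  obtain r where r: "strict_mono r" and "\<And>w. w \<in> UNIV \<Longrightarrow> \<exists>l. (\<lambda>k. a (r k) w) \<longlonglongrightarrow> l"
    by (rule function_convergent_subsequence[of UNIV a, OF countableI_type a_le]) blast
  then obtain c where c: "\<And>w. (\<lambda>k. a (r k) w) \<longlonglongrightarrow> c w" by (metis UNIV_I)
  have "\<exists>M. prob_space M \<and> sets M = sets streamS \<and> (\<forall>w. measure M (sstart UNIV w) = c w)"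
  proof (rule ex_stream_measure)
    show "0 \<le> c w" for w
      by (rule LIMSEQ_le_const[OF c]) (simp add: a_def)
    have "a n [] = 1" for n
      using prob_space.prob_space[OF N(1), of n] sets_eq_imp_space_eq[OF N(2), of n]
      by (simp add: a_def space_stream_space)
    then show "c [] = 1"
      using LIMSEQ_unique[OF c[of "[]"]] by simp
    show "(\<Sum>b\<in>UNIV. c (w @ [b])) = c w" for w
    proof (rule LIMSEQ_unique[OF _ c])
      have "(\<lambda>k. \<Sum>b\<in>UNIV. a (r k) (w @ [b])) \<longlonglongrightarrow> (\<Sum>b\<in>UNIV. c (w @ [b]))"
        by (intro tendsto_sum c)
      then show "(\<lambda>k. a (r k) w) \<longlonglongrightarrow> (\<Sum>b\<in>UNIV. c (w @ [b]))"
        unfolding a_def by (simp only: sum_measure_sstart_snoc[OF N])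
    qed
  qed
  then obtain M where M: "prob_space M" "sets M = sets streamS" and M_cyl: "\<And>w. measure M (sstart UNIV w) = c w"
    by auto
  have lim_stake: "(\<lambda>k. \<integral>s. F (stake m s) \<partial>N (r k)) \<longlonglongrightarrow> (\<integral>s. F (stake m s) \<partial>M)" for F :: "'s list \<Rightarrow> real" and m
    unfolding integral_stake[OF N] integral_stake[OF M] M_cyl a_def[symmetric]
    by (intro tendsto_intros c)
  have "c w = (\<integral>s. transfer g (indicator (sstart UNIV w)) s \<partial>M)" for w
  proof -
    let ?f = "transfer g (indicator (sstart UNIV w))"
    have f: "?f \<in> borel_measurable streamS"
      by (rule borel_measurable_transfer[OF g(1)]) (simp add: cyl)
    have f_bd: "\<bar>?f s\<bar> \<le> 1" for s
      by (rule transfer_bounded[OF g(1)]) simp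
    \<comment> \<open>Convergence is known for functions of finitely many letters. One third of
      \<open>e\<close> each pays for replacing \<open>?f\<close> by such a function under
      \<open>N (r k)\<close>, for replacing it under \<open>M\<close>, and for the convergence
      itself.\<close>
    have "(\<lambda>k. \<integral>s. ?f s \<partial>N (r k)) \<longlonglongrightarrow> (\<integral>s. ?f s \<partial>M)"
    proof (rule LIMSEQ_I)
      fix e :: real assume "0 < e"
      then obtain m where m: "\<And>s. \<bar>?f s - ?f (stake m s @- x)\<bar> < e / 3"
        using transfer_sstart_approx[OF g(1,2), of "e / 3" w] by auto
      let ?F = "\<lambda>u. ?f (u @- x)"
      have close: "\<bar>(\<integral>s. ?f s \<partial>R) - (\<integral>s. ?F (stake m s) \<partial>R)\<bar> \<le> e / 3"
        if R: "prob_space R" "sets R = sets streamS" for R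
      proof -
        interpret R: prob_space R by fact
        have "(\<lambda>s. ?F (stake m s)) \<in> borel_measurable streamS"
          by (rule measurable_compose[OF measurable_stake]) simp
        then have F: "(\<lambda>s. ?F (stake m s)) \<in> borel_measurable R"
          using measurable_cong_sets[OF R(2) refl] by blast
        have "?f \<in> borel_measurable R"
          using f measurable_cong_sets[OF R(2) refl] by blast
        then have i: "integrable R ?f" "integrable R (\<lambda>s. ?F (stake m s))"
          using F f_bd by (auto intro!: R.integrable_const_bound[where B=1])
        have "\<bar>(\<integral>s. ?f s \<partial>R) - (\<integral>s. ?F (stake m s) \<partial>R)\<bar> \<le> (\<integral>s. \<bar>?f s - ?F (stake m s)\<bar> \<partial>R)"
          using i integral_abs_bound[of R "\<lambda>s. ?f s - ?F (stake m s)"] by simp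
        also have "\<dots> \<le> e / 3"
          using i m by (intro R.integral_le_const) (auto intro: less_imp_le)
        finally show ?thesis .
      qed
      obtain k0 where k0: "\<And>k. k0 \<le> k \<Longrightarrow> \<bar>(\<integral>s. ?F (stake m s) \<partial>N (r k)) - (\<integral>s. ?F (stake m s) \<partial>M)\<bar> < e / 3"
        using LIMSEQ_D[OF lim_stake[of ?F m], of "e / 3"] \<open>0 < e\<close> by auto
      have "norm ((\<integral>s. ?f s \<partial>N (r k)) - (\<integral>s. ?f s \<partial>M)) < e" if "k0 \<le> k" for k
        using k0[OF that] close[OF M] close[OF N, of "r k"] unfolding real_norm_def by linarith
      then show "\<exists>k0. \<forall>k\<ge>k0. norm ((\<integral>s. ?f s \<partial>N (r k)) - (\<integral>s. ?f s \<partial>M)) < e" by blast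
    qed
    \<comment> \<open>By \<open>a_Suc\<close> this is the sequence of integrals just treated, while
      \<open>a_shift\<close> gives it the limit of \<open>a (r k) w\<close>. The two limits
      coincide.\<close>
    moreover have "(\<lambda>k. a (Suc (r k)) w) \<longlonglongrightarrow> c w"
      using tendsto_add[OF LIMSEQ_subseq_LIMSEQ[OF a_shift[of w] r] c[of w]] by (simp add: comp_def)
    ultimately show ?thesis
      unfolding a_Suc by (blast intro: LIMSEQ_unique)
  qed
  then show ?thesis
    using M M_cyl by auto
qed

text \<open>The chain is started from a random past with the invariant law \<open>M\<close>. After
  one step the past has law \<open>M\<close> again, which yields stationarity; the kernel condition
  holds because every chain follows \<open>g\<close>.\<close>

lemma ex_g_measure:
  fixes g :: "'s::finite stream \<Rightarrow> real"
  assumes g: "kernel g" "continuous_kernel g" "dynamic_uniqueness g"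
  shows "\<exists>P. g_measure g P"
proof -
  obtain M where M: "prob_space M" "sets M = sets streamS"
    and M_cyl: "\<And>w. measure M (sstart UNIV w) = (\<integral>s. transfer g (indicator (sstart UNIV w)) s \<partial>M)"
    using ex_invariant_past[OF g] by auto
  let ?P = "M \<bind> chain g"
  note P = bind_chain_prob_space[OF g(1) M]
  interpret P: prob_space ?P by (rule P)
  note [measurable] = measurable_past_sets[OF P(2)] measurable_shift_by_sets[OF P(2)]
  have sp: "space ?P = UNIV"
    using sets_eq_imp_space_eq[OF P(2)] by simp
  have int: "(\<integral>z. f (past (int n - 1) z) \<partial>?P) = (\<integral>s. (transfer g ^^ n) f s \<partial>M)"
    if "f \<in> borel_measurable streamS" "\<And>s. \<bar>f s\<bar> \<le> 1" for f n
    by (rule integral_bind_chain[OF g(1) M that])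
  \<comment> \<open>Invariance is given on cylinders only. Equality of laws extends it to all
    bounded measurable functions in \<open>inv\<close>.\<close>
  have eq_M: "distr ?P streamS (past 0) = M"
  proof (rule stream_measure_eqI[OF M])
    show "prob_space (distr ?P streamS (past 0))" by (intro P.prob_space_distr) measurable
    fix w :: "'s list"
    have "measure (distr ?P streamS (past 0)) (sstart UNIV w) = (\<integral>z. indicator (sstart UNIV w) (past 0 z) \<partial>?P)"
      by (subst integral_distr[symmetric, of _ _ streamS]) (auto simp: sstart_sets space_stream_space)
    then show "measure (distr ?P streamS (past 0)) (sstart UNIV w) = measure M (sstart UNIV w)"
      using int[of "indicator (sstart UNIV w)" 1] by (simp add: M_cyl sstart_sets)
  qed simp
  have inv: "(\<integral>s. transfer g f s \<partial>M) = (\<integral>s. f s \<partial>M)"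
    if f: "f \<in> borel_measurable streamS" "\<And>s. \<bar>f s\<bar> \<le> 1" for f
  proof -
    have "(\<integral>s. f s \<partial>distr ?P streamS (past 0)) = (\<integral>z. f (past 0 z) \<partial>?P)"
      using f(1) by (intro integral_distr) auto
    then show ?thesis using int[OF f, of 1] by (simp add: eq_M)
  qed
  have "follows_kernel_at 0 g ?P"
  proof (rule follows_kernel_atI[OF g(1) P])
    fix B :: "'s stream set" assume B: "B \<in> sets streamS"
    then have t: "transfer g (indicator B) \<in> borel_measurable streamS"
      by (intro borel_measurable_transfer[OF g(1)]) simp
    have bd: "\<bar>transfer g (indicator B) s\<bar> \<le> 1" for s
      by (rule transfer_bounded[OF g(1)]) simp
    show "(\<integral>z. indicator B (past 0 z) \<partial>?P) = (\<integral>z. transfer g (indicator B) (past (0 - 1) z) \<partial>?P)"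
      using int[of "indicator B" 1] int[OF t bd, of 0] B by simp
  qed
  moreover have "stationary ?P"
  proof -
    let ?Q = "distr ?P (coord_alg UNIV) (shift_by 1)"
    have Q: "prob_space ?Q" by (intro P.prob_space_distr) measurable
    interpret Q: prob_space ?Q by (rule Q)
    have "?Q = ?P"
    proof (rule prob_eqI_past[OF Q _ P(2)])
      fix n :: nat and B :: "'s stream set" assume B: "B \<in> sets streamS"
      have t: "(transfer g ^^ n) (indicator B) \<in> borel_measurable streamS"
        using B by (intro borel_measurable_iterated_transfer[OF g(1), where C=1]) auto
      have bd: "\<bar>(transfer g ^^ n) (indicator B) s\<bar> \<le> 1" for s
        using B by (intro iterated_transfer_bounded[OF g(1)]) auto
      have ev: "past j -` B \<in> sets ?P" for j
        using measurable_sets[OF measurable_past_UNIV B, of j] by (simp add: P(2))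
      have ind: "(\<integral>z. indicator B (past j z) \<partial>?P) = measure ?P (past j -` B)" for j
      proof -
        have "(indicator B (past j z) :: real) = indicator (past j -` B) z" for z
          by (simp add: indicator_def)
        then show ?thesis using ev[of j] by (simp add: sp)
      qed
      have "measure ?Q (past (int n - 1) -` B) = measure ?P (past (int (Suc n) - 1) -` B)"
        using ev P(2) by (subst measure_distr) (auto simp: sp vimage_def past_shift_by)
      \<comment> \<open>The shift costs one more transfer, and the outermost one is absorbed by
        \<open>inv\<close>.\<close>
      also have "\<dots> = (\<integral>s. (transfer g ^^ n) (indicator B) s \<partial>M)"
        using int[of "indicator B" "Suc n"] inv[OF t bd] B by (simp add: ind)
      also have "\<dots> = measure ?P (past (int n - 1) -` B)"
        using int[of "indicator B" n] B by (simp add: ind)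
      finally show "emeasure ?Q (past (int n - 1) -` B) = emeasure ?P (past (int n - 1) -` B)"
        by (simp only: P.emeasure_eq_measure Q.emeasure_eq_measure)
    qed simp
    moreover have "distr ?P ?P (\<lambda>z i. z (i + 1)) = ?Q"
      by (rule distr_cong) (auto simp: P(2) shift_by_def)
    ultimately show ?thesis by (simp add: stationary_def)
  qed
  ultimately show ?thesis
    using P by (auto simp: g_measure_def)
qed

theorem theorem2:
  fixes g :: "'s::finite stream \<Rightarrow> real"
  assumes "regular_kernel g" and "dynamic_uniqueness g"
  shows "(\<exists>!P. g_measure g P) \<and> (\<forall>P. g_measure g P \<longrightarrow> weak_bernoulli P)"
proof -
  have "kernel g" "continuous_kernel g"
    using assms(1) by (auto simp: regular_kernel_def)
  then show ?thesis
    using ex_g_measure g_measure_unique g_measure_weak_bernoulli assms(2) by blast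
qed

end
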